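(* Suppose $1\to H\to G\xrightarrow{\pi} K\to 1$ is a short exact sequence of topological groups. Then if $H$ and $K$ are CAP, then so is $G$.
   Context: All topological groups and spaces are Hausdorff. For a topological group $G$, a $G$-flow is a (non-empty) compact Hausdorff space with a continuous left action of $G$; a subflow is a non-empty closed $G$-invariant subset; a flow is minimal if it has no proper subflow. For a $G$-flow $X$, $\mathrm{AP}_G(X)=\{x\in X:\overline{Gx}\text{ is minimal}\}$. $G$ is CAP if $\mathrm{AP}_G(X)$ is closed in $X$ for every $G$-flow $X$. A short exact sequence $1\to H\to G\xrightarrow{\pi} K\to 1$ of topological groups means that $H$ is (identified with) a closed normal subgroup of $G$ with the subspace topology and $\pi$ induces an isomorphism of topological groups $G/H\cong K$, where $G/H$ has the quotient topology. *)

theory Defs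
  imports "HOL-Analysis.Analysis" "HOL-Algebra.Group_Action"
begin

definition topological_group :: "('g, 'm) monoid_scheme \<Rightarrow> 'g topology \<Rightarrow> bool" where
  "topological_group G T \<longleftrightarrow>
     group G \<and> topspace T = carrier G \<and> Hausdorff_space T \<and>
     continuous_map (prod_topology T T) T (\<lambda>(g, h). g \<otimes>\<^bsub>G\<^esub> h) \<and>
     continuous_map T T (\<lambda>g. inv\<^bsub>G\<^esub> g)"

definition flow ::
  "('g, 'm) monoid_scheme \<Rightarrow> 'g topology \<Rightarrow> 'x topology \<Rightarrow> ('g \<Rightarrow> 'x \<Rightarrow> 'x) \<Rightarrow> bool" where
  "flow G T X \<phi> \<longleftrightarrow>
     topspace X \<noteq> {} \<and> compact_space X \<and> Hausdorff_space X \<and>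
     group_action G (topspace X) \<phi> \<and>
     continuous_map (prod_topology T X) X (\<lambda>(g, x). \<phi> g x)"

definition subflow ::
  "('g, 'm) monoid_scheme \<Rightarrow> 'x topology \<Rightarrow> ('g \<Rightarrow> 'x \<Rightarrow> 'x) \<Rightarrow> 'x set \<Rightarrow> bool" where
  "subflow G X \<phi> Y \<longleftrightarrow>
     Y \<noteq> {} \<and> closedin X Y \<and> (\<forall>g\<in>carrier G. \<phi> g ` Y \<subseteq> Y)"

definition minimal_flow ::
  "('g, 'm) monoid_scheme \<Rightarrow> 'g topology \<Rightarrow> 'x topology \<Rightarrow> ('g \<Rightarrow> 'x \<Rightarrow> 'x) \<Rightarrow> bool" where
  "minimal_flow G T X \<phi> \<longleftrightarrow>
     flow G T X \<phi> \<and> (\<forall>Y. subflow G X \<phi> Y \<longrightarrow> Y = topspace X)"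

text \<open>The restriction below is forced by \<^const>\<open>group_action\<close>, which asks each
  \<open>\<phi> g\<close> to be extensional on the space acted upon.\<close>

definition AP ::
  "('g, 'm) monoid_scheme \<Rightarrow> 'g topology \<Rightarrow> 'x topology \<Rightarrow> ('g \<Rightarrow> 'x \<Rightarrow> 'x) \<Rightarrow> 'x set" where
  "AP G T X \<phi> =
     {x \<in> topspace X.
        let C = X closure_of (orbit G \<phi> x)
        in minimal_flow G T (subtopology X C) (\<lambda>g. restrict (\<phi> g) C)}"

definition CAP_on :: "'x itself \<Rightarrow> ('g, 'm) monoid_scheme \<Rightarrow> 'g topology \<Rightarrow> bool" where
  "CAP_on _ G T \<longleftrightarrow>
     (\<forall>(X :: 'x topology) \<phi>. flow G T X \<phi> \<longrightarrow> closedin X (AP G T X \<phi>))"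

text \<open>A HOL formula cannot quantify over the types that carry flows, so the flows are
  taken on subsets of one type, functions from the group to the reals. This loses nothing:
  by \<open>CAP_imp_CAP_on\<close> below, a topological group with this property has
  \<^const>\<open>AP\<close> closed in each of its flows, on every type.\<close>

definition CAP :: "('g, 'm) monoid_scheme \<Rightarrow> 'g topology \<Rightarrow> bool" where
  "CAP G T \<longleftrightarrow> CAP_on TYPE('g \<Rightarrow> real) G T"

definition quotient_group_topology ::
  "('g, 'm) monoid_scheme \<Rightarrow> 'g topology \<Rightarrow> 'g set \<Rightarrow> 'g set topology" where
  "quotient_group_topology G T H =
     topology (\<lambda>U. U \<subseteq> carrier (G Mod H) \<and> openin T {g \<in> carrier G. H #>\<^bsub>G\<^esub> g \<in> U})"

text \<open>The subgroup \<open>H\<close> carries the subspace topology; \<open>\<lambda>C. the_elem (\<pi> ` C)\<close> is the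
  map on cosets induced by \<open>\<pi>\<close>.\<close>

definition short_exact_sequence ::
  "'g set \<Rightarrow> ('g, 'm) monoid_scheme \<Rightarrow> 'g topology \<Rightarrow>
   ('g \<Rightarrow> 'k) \<Rightarrow> ('k, 'n) monoid_scheme \<Rightarrow> 'k topology \<Rightarrow> bool" where
  "short_exact_sequence H G T \<pi> K S \<longleftrightarrow>
     topological_group G T \<and> topological_group K S \<and>
     H \<lhd> G \<and> closedin T H \<and>
     \<pi> \<in> hom G K \<and> kernel G K \<pi> = H \<and>
     (\<lambda>C. the_elem (\<pi> ` C)) \<in> iso (G Mod H) K \<and>
     homeomorphic_map (quotient_group_topology G T H) S (\<lambda>C. the_elem (\<pi> ` C))"


lemma openin_quotient_group_topology:
  "openin (quotient_group_topology G T H) U \<longleftrightarrow>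
     U \<subseteq> carrier (G Mod H) \<and> openin T {g \<in> carrier G. H #>\<^bsub>G\<^esub> g \<in> U}"
proof -
  have "istopology (\<lambda>U. U \<subseteq> carrier (G Mod H) \<and> openin T {g \<in> carrier G. H #>\<^bsub>G\<^esub> g \<in> U})"
    unfolding istopology_def
  proof (intro conjI allI impI)
    fix U V
    assume U: "U \<subseteq> carrier (G Mod H) \<and> openin T {g \<in> carrier G. H #>\<^bsub>G\<^esub> g \<in> U}"
      and V: "V \<subseteq> carrier (G Mod H) \<and> openin T {g \<in> carrier G. H #>\<^bsub>G\<^esub> g \<in> V}"
    show "U \<inter> V \<subseteq> carrier (G Mod H)" using U by blast
    have "{g \<in> carrier G. H #>\<^bsub>G\<^esub> g \<in> U \<inter> V} =
      {g \<in> carrier G. H #>\<^bsub>G\<^esub> g \<in> U} \<inter> {g \<in> carrier G. H #>\<^bsub>G\<^esub> g \<in> V}" by blast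
    then show "openin T {g \<in> carrier G. H #>\<^bsub>G\<^esub> g \<in> U \<inter> V}" using U V by auto
  next
    fix \<K>
    assume K: "\<forall>U\<in>\<K>. U \<subseteq> carrier (G Mod H) \<and> openin T {g \<in> carrier G. H #>\<^bsub>G\<^esub> g \<in> U}"
    show "\<Union>\<K> \<subseteq> carrier (G Mod H)" using K by blast
    have "{g \<in> carrier G. H #>\<^bsub>G\<^esub> g \<in> \<Union>\<K>} = (\<Union>U\<in>\<K>. {g \<in> carrier G. H #>\<^bsub>G\<^esub> g \<in> U})"
      by blast
    then show "openin T {g \<in> carrier G. H #>\<^bsub>G\<^esub> g \<in> \<Union>\<K>}" using K by auto
  qed
  then show ?thesis
    by (simp add: quotient_group_topology_def)
qed

lemma quotient_map_quotient_group_topology: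
  assumes "topspace T = carrier G"
  shows "quotient_map T (quotient_group_topology G T H) (\<lambda>g. H #>\<^bsub>G\<^esub> g)"
proof -
  have img: "(\<lambda>g. H #>\<^bsub>G\<^esub> g) ` carrier G = carrier (G Mod H)"
    by (auto simp: FactGroup_def RCOSETS_def)
  have "{g \<in> carrier G. H #>\<^bsub>G\<^esub> g \<in> carrier (G Mod H)} = topspace T"
    using assms img by auto
  then have "openin (quotient_group_topology G T H) (carrier (G Mod H))"
    by (simp add: openin_quotient_group_topology)
  then have "topspace (quotient_group_topology G T H) = carrier (G Mod H)"
    by (meson openin_quotient_group_topology openin_subset openin_topspace subset_antisym)
  then show ?thesis
    using assms img by (auto simp: quotient_map_def openin_quotient_group_topology)
qed

lemma topological_group_subgroup:
  assumes G: "topological_group G T" and H: "subgroup H G"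
  shows "topological_group (G\<lparr>carrier := H\<rparr>) (subtopology T H)"
proof -
  interpret group G using G by (simp add: topological_group_def)
  have top: "topspace T = carrier G" and T: "Hausdorff_space T"
    and m: "continuous_map (prod_topology T T) T (\<lambda>(g, h). g \<otimes>\<^bsub>G\<^esub> h)"
    and i: "continuous_map T T (\<lambda>g. inv\<^bsub>G\<^esub> g)"
    using G by (auto simp: topological_group_def)
  have sub: "H \<subseteq> carrier G" using H by (rule subgroup.subset)
  have "continuous_map (prod_topology (subtopology T H) (subtopology T H)) (subtopology T H)
          (\<lambda>(g, h). g \<otimes>\<^bsub>G\<^esub> h)"
    using m H by (auto simp: prod_topology_subtopology subtopology_subtopology
        continuous_map_in_subtopology subgroup.m_closed
        intro!: continuous_map_from_subtopology)
  moreover have "continuous_map (subtopology T H) (subtopology T H) (\<lambda>g. inv\<^bsub>G\<^esub> g)"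
    using i H by (auto simp: continuous_map_in_subtopology subgroup.m_inv_closed
        intro!: continuous_map_from_subtopology)
  then have "continuous_map (subtopology T H) (subtopology T H) (\<lambda>g. inv\<^bsub>G\<lparr>carrier := H\<rparr>\<^esub> g)"
    by (rule continuous_map_eq) (use H m_inv_consistent in auto)
  ultimately show ?thesis
    using sub top T subgroup.subgroup_is_group[OF H]
    by (auto simp: topological_group_def Hausdorff_space_subtopology)
qed

lemma group_actionI:
  assumes "group G"
    and ext: "\<And>g. g \<in> carrier G \<Longrightarrow> \<phi> g \<in> extensional E"
    and cl: "\<And>g x. g \<in> carrier G \<Longrightarrow> x \<in> E \<Longrightarrow> \<phi> g x \<in> E"
    and one: "\<And>x. x \<in> E \<Longrightarrow> \<phi> \<one>\<^bsub>G\<^esub> x = x"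
    and mult: "\<And>g h x. g \<in> carrier G \<Longrightarrow> h \<in> carrier G \<Longrightarrow> x \<in> E \<Longrightarrow>
                 \<phi> (g \<otimes>\<^bsub>G\<^esub> h) x = \<phi> g (\<phi> h x)"
  shows "group_action G E \<phi>"
proof -
  interpret group G by fact
  have "bij_betw (\<phi> g) E E" if g: "g \<in> carrier G" for g
  proof (rule bij_betw_byWitness[where f' = "\<phi> (inv\<^bsub>G\<^esub> g)"])
    show "\<forall>x\<in>E. \<phi> (inv\<^bsub>G\<^esub> g) (\<phi> g x) = x"
      using g by (metis inv_closed l_inv mult one)
    show "\<forall>x\<in>E. \<phi> g (\<phi> (inv\<^bsub>G\<^esub> g) x) = x"
      using g by (metis inv_closed r_inv mult one)
  qed (use g cl in auto)
  then have bij: "\<phi> g \<in> Bij E" if "g \<in> carrier G" for g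
    using that ext by (auto simp: Bij_def)
  have "\<phi> (g \<otimes>\<^bsub>G\<^esub> h) = compose E (\<phi> g) (\<phi> h)" if "g \<in> carrier G" "h \<in> carrier G" for g h
    by (rule extensionalityI[where A = E])
       (use that ext mult in \<open>auto simp: compose_eq compose_extensional\<close>)
  then have "\<phi> \<in> hom G (BijGroup E)"
    using bij by (auto simp: hom_def BijGroup_def)
  then show ?thesis
    by (simp add: group_action_def group_hom_def group_hom_axioms_def group_BijGroup assms(1))
qed

lemma flow_subflow:
  assumes fl: "flow G T X \<phi>" and Y: "subflow G X \<phi> Y" and top: "topspace T = carrier G"
  shows "flow G T (subtopology X Y) (\<lambda>g. restrict (\<phi> g) Y)"
proof -
  interpret group_action G "topspace X" \<phi> using fl by (simp add: flow_def)
  interpret group G using group_hom group_hom.axioms(1) by blast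
  have sub: "Y \<subseteq> topspace X" using Y closedin_subset by (auto simp: subflow_def)
  have inv: "\<phi> g y \<in> Y" if "g \<in> carrier G" "y \<in> Y" for g y
    using Y that by (auto simp: subflow_def)
  have one: "\<phi> \<one>\<^bsub>G\<^esub> y = y" if "y \<in> Y" for y
    using id_eq_one that sub by (metis restrict_apply' subsetD)
  have "group_action G Y (\<lambda>g. restrict (\<phi> g) Y)"
    by (rule group_actionI)
       (use inv one sub composition_rule in \<open>auto simp: is_group\<close>)
  moreover have "continuous_map (prod_topology T (subtopology X Y)) X (\<lambda>(g, x). \<phi> g x)"
    using fl by (auto simp: flow_def prod_topology_subtopology intro: continuous_map_from_subtopology)
  then have "continuous_map (prod_topology T (subtopology X Y)) X (\<lambda>(g, x). restrict (\<phi> g) Y x)"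
    by (rule continuous_map_eq) auto
  then have "continuous_map (prod_topology T (subtopology X Y)) (subtopology X Y)
      (\<lambda>(g, x). restrict (\<phi> g) Y x)"
    using inv top by (auto simp: continuous_map_in_subtopology)
  ultimately show ?thesis
    using fl Y sub
    by (auto simp: flow_def subflow_def Hausdorff_space_subtopology Int_absorb1
        closedin_compact_space compact_space_subtopology)
qed

lemma subflow_orbit_closure:
  assumes fl: "flow G T X \<phi>" and top: "topspace T = carrier G" and x: "x \<in> topspace X"
  shows "subflow G X \<phi> (X closure_of (orbit G \<phi> x))"
    and "x \<in> X closure_of (orbit G \<phi> x)"
proof -
  interpret group_action G "topspace X" \<phi> using fl by (simp add: flow_def)
  interpret group G using group_hom group_hom.axioms(1) by blast
  have osub: "orbit G \<phi> x \<subseteq> topspace X"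
    using element_image x by (auto simp: orbit_def)
  show xin: "x \<in> X closure_of (orbit G \<phi> x)"
    using closure_of_subset[OF osub] orbit_refl[OF x] by blast
  have "\<phi> g ` (X closure_of (orbit G \<phi> x)) \<subseteq> X closure_of (orbit G \<phi> x)" if g: "g \<in> carrier G" for g
  proof -
    have c: "continuous_map (prod_topology T X) X (\<lambda>(g, x). \<phi> g x)"
      using fl by (simp add: flow_def)
    have "continuous_map X (prod_topology T X) (\<lambda>x. (g, x))"
      using g top by (intro continuous_map_pairedI) auto
    from continuous_map_compose[OF this c] have "continuous_map X X (\<phi> g)"
      by (simp add: o_def)
    then have "\<phi> g ` (X closure_of (orbit G \<phi> x)) \<subseteq> X closure_of (\<phi> g ` (orbit G \<phi> x))"
      using osub by (auto simp: continuous_map_eq_image_closure_subset)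
    also have "\<dots> \<subseteq> X closure_of (orbit G \<phi> x)"
    proof (rule closure_of_mono)
      show "\<phi> g ` (orbit G \<phi> x) \<subseteq> orbit G \<phi> x"
      proof clarify
        fix y assume "y \<in> orbit G \<phi> x"
        then obtain h where "h \<in> carrier G" "y = \<phi> h x" by (auto simp: orbit_def)
        then have "\<phi> g y = \<phi> (g \<otimes>\<^bsub>G\<^esub> h) x" "g \<otimes>\<^bsub>G\<^esub> h \<in> carrier G"
          using composition_rule[OF x g] g by auto
        then show "\<phi> g y \<in> orbit G \<phi> x" by (auto simp: orbit_def)
      qed
    qed
    finally show ?thesis .
  qed
  with xin show "subflow G X \<phi> (X closure_of (orbit G \<phi> x))"
    by (auto simp: subflow_def)
qed

lemma AP_iff:
  assumes fl: "flow G T X \<phi>" and top: "topspace T = carrier G"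
  shows "x \<in> AP G T X \<phi> \<longleftrightarrow> x \<in> topspace X \<and>
     (\<forall>Y. subflow G X \<phi> Y \<longrightarrow> Y \<subseteq> X closure_of (orbit G \<phi> x) \<longrightarrow>
          Y = X closure_of (orbit G \<phi> x))"
proof (cases "x \<in> topspace X")
  case x: True
  define C where "C = X closure_of (orbit G \<phi> x)"
  have C: "subflow G X \<phi> C" "C \<subseteq> topspace X" "closedin X C"
    unfolding C_def using subflow_orbit_closure[OF fl top x] by (auto simp: closure_of_subset_topspace)
  have "subflow G (subtopology X C) (\<lambda>g. restrict (\<phi> g) C) Y \<longleftrightarrow> subflow G X \<phi> Y \<and> Y \<subseteq> C" for Y
  proof -
    have "restrict (\<phi> g) C ` Y = \<phi> g ` Y" if "Y \<subseteq> C" for g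
      using that by (auto simp: subset_iff image_iff)
    then show ?thesis
      unfolding subflow_def closedin_closed_subtopology[OF C(3)] by metis
  qed
  then show ?thesis
    using x C flow_subflow[OF fl C(1) top]
    by (auto simp: AP_def Let_def minimal_flow_def Int_absorb1 simp flip: C_def)
qed (simp add: AP_def)

theorem CAP_imp_CAP_on:
  fixes G :: "('g, 'm) monoid_scheme"
  assumes tg: "topological_group G T" and cap: "CAP G T"
  shows "CAP_on TYPE('x) G T"
  unfolding CAP_on_def
proof (intro allI impI)
  fix X :: "'x topology" and \<phi>
  assume fl: "flow G T X \<phi>"
  have top: "topspace T = carrier G" and
    mc: "continuous_map (prod_topology T T) T (\<lambda>(g, h). g \<otimes>\<^bsub>G\<^esub> h)"
    using tg by (simp_all add: topological_group_def)
  interpret act: group_action G "topspace X" \<phi> using fl by (simp add: flow_def)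
  interpret group G using tg by (simp add: topological_group_def)
  have cX: "compact_space X" "Hausdorff_space X" "topspace X \<noteq> {}"
    and cact: "continuous_map (prod_topology T X) X (\<lambda>(g, x). \<phi> g x)"
    using fl by (auto simp: flow_def)
  have phi: "\<phi> g z \<in> topspace X" if "g \<in> carrier G" "z \<in> topspace X" for g z
    using act.element_image that by blast
  have phi1: "\<phi> \<one>\<^bsub>G\<^esub> z = z" if "z \<in> topspace X" for z
    using act.id_eq_one that by (metis restrict_apply')
  have APsub: "AP G T X \<phi> \<subseteq> topspace X" by (auto simp: AP_def)
  have "x \<in> AP G T X \<phi>" if xcl: "x \<in> X closure_of (AP G T X \<phi>)" for x
  proof (rule ccontr)
    assume xn: "x \<notin> AP G T X \<phi>"
    have x: "x \<in> topspace X" using xcl by (simp add: in_closure_of)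
    define C where "C = X closure_of (orbit G \<phi> x)"
    obtain Y where Y: "subflow G X \<phi> Y" "Y \<subseteq> C" "Y \<noteq> C"
      using xn x AP_iff[OF fl top] unfolding C_def by blast
    have "x \<notin> Y"
    proof
      assume "x \<in> Y"
      then have "orbit G \<phi> x \<subseteq> Y" using Y by (auto simp: subflow_def orbit_def)
      then have "C \<subseteq> Y" unfolding C_def using Y by (simp add: subflow_def closure_of_minimal)
      with Y show False by blast
    qed
    moreover have clY: "closedin X Y" using Y by (simp add: subflow_def)
    moreover have "completely_regular_space X"
      using cX compact_Hausdorff_or_regular_imp_normal_space
        normal_imp_completely_regular_space_gen Hausdorff_imp_t1_space by blast
    ultimately obtain f where f: "continuous_map X euclideanreal f" "f x = 0" "f ` Y \<subseteq> {1}"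
      using x unfolding completely_regular_space_alt by (metis DiffI)
    define F where "F = (\<lambda>z. \<lambda>g\<in>carrier G. f (\<phi> g z))"
    define P where "P = product_topology (\<lambda>_::'g. euclideanreal) (carrier G)"
    define Z where "Z = subtopology P (F ` topspace X)"
    define \<psi> where "\<psi> = (\<lambda>g. \<lambda>w\<in>F ` topspace X. \<lambda>h\<in>carrier G. w (h \<otimes>\<^bsub>G\<^esub> g))"
    have cphi: "continuous_map X X (\<phi> g)" if "g \<in> carrier G" for g
    proof -
      have "continuous_map X (prod_topology T X) (\<lambda>x. (g, x))"
        using that top by (intro continuous_map_pairedI) auto
      from continuous_map_compose[OF this cact] show ?thesis by (simp add: o_def)
    qed
    have cFP: "continuous_map X P F"
      unfolding P_def F_def
      using continuous_map_compose[OF cphi f(1)]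
      by (auto simp: continuous_map_componentwise o_def)
    have topZ: "topspace Z = F ` topspace X"
      unfolding Z_def using continuous_map_image_subset_topspace[OF cFP] by auto
    have cF: "continuous_map X Z F"
      using cFP by (auto simp: Z_def continuous_map_in_subtopology)
    have HZ: "Hausdorff_space Z"
      unfolding Z_def P_def
      by (intro Hausdorff_space_subtopology) (auto simp: Hausdorff_space_product_topology)
    have clF: "closed_map X Z F" using cF cX(1) HZ by (rule T1_Spaces.continuous_imp_closed_map)
    have compZ: "compact_space Z"
      using image_compactin[of X "topspace X" Z F] cF cX(1) topZ by (simp add: compact_space_def)
    have psi: "\<psi> g (F z) = F (\<phi> g z)" if "g \<in> carrier G" "z \<in> topspace X" for g z
      using that act.composition_rule by (auto simp: \<psi>_def F_def fun_eq_iff restrict_def)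
    have actZ: "group_action G (topspace Z) \<psi>"
    proof (rule group_actionI)
      show "\<psi> g \<in> extensional (topspace Z)" for g by (auto simp: \<psi>_def topZ)
    qed (use psi phi phi1 act.composition_rule topZ in \<open>auto simp: is_group\<close>)
    have cpsi: "continuous_map (prod_topology T Z) Z (\<lambda>(g, w). \<psi> g w)"
    proof (rule continuous_compose_quotient_map)
      have "proper_map X Z F"
        using cX(1) HZ cF by (simp add: Hausdorff_imp_kc_space continuous_imp_proper_map)
      then have "proper_map (prod_topology T X) (prod_topology T Z) (\<lambda>(g, z). (id g, F z))"
        by (subst proper_map_prod) (simp add: proper_map_id[unfolded id_def] id_def)
      then have "closed_map (prod_topology T X) (prod_topology T Z) (\<lambda>(g, z). (id g, F z))"
        by (rule proper_imp_closed_map)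
      moreover have "continuous_map (prod_topology T X) (prod_topology T Z) (\<lambda>(g, z). (id g, F z))"
        using cF by (simp add: continuous_map_prod_top)
      ultimately show "quotient_map (prod_topology T X) (prod_topology T Z) (\<lambda>(g, z). (id g, F z))"
        by (intro continuous_closed_imp_quotient_map) (auto simp: topZ image_iff)
      have "continuous_map (prod_topology T X) Z (F \<circ> (\<lambda>(g, z). \<phi> g z))"
        using cact cF by (rule continuous_map_compose)
      then show "continuous_map (prod_topology T X) Z ((\<lambda>(g, w). \<psi> g w) \<circ> (\<lambda>(g, z). (id g, F z)))"
        by (rule continuous_map_eq) (auto simp: psi top)
    qed
    have flZ: "flow G T Z \<psi>"
      using compZ HZ actZ cpsi topZ cX(3) by (auto simp: flow_def)
    have orb: "orbit G \<psi> (F z) = F ` orbit G \<phi> z" if "z \<in> topspace X" for z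
      using psi that by (force simp: orbit_def)
    have clorb: "Z closure_of (orbit G \<psi> (F z)) = F ` (X closure_of (orbit G \<phi> z))"
      if z: "z \<in> topspace X" for z
    proof
      have os: "orbit G \<phi> z \<subseteq> topspace X" using phi z by (auto simp: orbit_def)
      show "Z closure_of (orbit G \<psi> (F z)) \<subseteq> F ` (X closure_of (orbit G \<phi> z))"
        using clF os by (simp add: orb[OF z] closed_map_closure_of_image)
      show "F ` (X closure_of (orbit G \<phi> z)) \<subseteq> Z closure_of (orbit G \<psi> (F z))"
        using cF os by (auto simp: orb[OF z] continuous_map_eq_image_closure_subset)
    qed
    have "F ` AP G T X \<phi> \<subseteq> AP G T Z \<psi>"
    proof clarify
      fix a assume a: "a \<in> AP G T X \<phi>"
      then have aX: "a \<in> topspace X" using APsub by blast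
      let ?C = "X closure_of (orbit G \<phi> a)"
      have C: "subflow G X \<phi> ?C" using subflow_orbit_closure[OF fl top aX] by simp
      have "W = F ` ?C" if W: "subflow G Z \<psi> W" "W \<subseteq> F ` ?C" for W
      proof -
        let ?D = "?C \<inter> {z \<in> topspace X. F z \<in> W}"
        have "closedin X {z \<in> topspace X. F z \<in> W}"
          using cF W by (auto simp: subflow_def continuous_map_closedin)
        then have "closedin X ?D" by (intro closedin_Int) auto
        moreover have "?D \<noteq> {}"
        proof -
          obtain w where w: "w \<in> W" using W by (auto simp: subflow_def)
          then obtain c where "c \<in> ?C" "F c = w" using W by blast
          moreover have "c \<in> topspace X" using \<open>c \<in> ?C\<close> by (simp add: in_closure_of)
          ultimately show ?thesis using w by blast
        qed
        moreover have "\<phi> g ` ?D \<subseteq> ?D" if g: "g \<in> carrier G" for g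
        proof clarify
          fix z assume z: "z \<in> ?C" "z \<in> topspace X" "F z \<in> W"
          have "\<psi> g (F z) \<in> W" using W(1) g z by (auto simp: subflow_def)
          then show "\<phi> g z \<in> ?D" using C g z psi[OF g z(2)] phi[OF g z(2)]
            by (auto simp: subflow_def)
        qed
        ultimately have "subflow G X \<phi> ?D" by (simp add: subflow_def)
        then have "?D = ?C" using a AP_iff[OF fl top] by blast
        then show ?thesis using W(2) by blast
      qed
      then show "F a \<in> AP G T Z \<psi>"
        using aX topZ by (simp add: AP_iff[OF flZ top] clorb[OF aX])
    qed
    moreover have "closedin Z (AP G T Z \<psi>)"
      using cap flZ by (simp add: CAP_def CAP_on_def)
    ultimately have "Z closure_of (F ` AP G T X \<phi>) \<subseteq> AP G T Z \<psi>"
      by (rule closure_of_minimal)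
    moreover have "F x \<in> Z closure_of (F ` AP G T X \<phi>)"
      using cF APsub xcl by (auto simp: continuous_map_eq_image_closure_subset)
    ultimately have Fx: "F x \<in> AP G T Z \<psi>" by blast
    have Ysub: "Y \<subseteq> topspace X" using clY closedin_subset by blast
    have "closedin Z (F ` Y)" using clF clY by (simp add: closed_map_def)
    moreover have "\<psi> g ` F ` Y \<subseteq> F ` Y" if "g \<in> carrier G" for g
      using that Y(1) Ysub psi by (fastforce simp: subflow_def)
    ultimately have "subflow G Z \<psi> (F ` Y)" using Y(1) by (simp add: subflow_def)
    then have "F ` Y = F ` C"
      using Fx Y(2) by (simp add: AP_iff[OF flZ top] clorb[OF x] image_mono flip: C_def)
    moreover have "x \<in> C" unfolding C_def using subflow_orbit_closure[OF fl top x] by simp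
    ultimately obtain y where y: "y \<in> Y" "F y = F x" by (metis imageE imageI)
    then have "F y \<one>\<^bsub>G\<^esub> = F x \<one>\<^bsub>G\<^esub>" by simp
    then have "f y = f x" using y Ysub x phi1 by (auto simp: F_def)
    then show False using f y by auto
  qed
  then show "closedin X (AP G T X \<phi>)"
    using APsub by (metis closure_of_eq closure_of_subset subsetI subset_antisym)
qed

end

theory Submission
  imports Defs
begin

text \<open>
  The proof replaces CAP by a quantitative form of recurrence that passes to extensions.  Say
  that \<open>G\<close> is uniformly recurrent if for every neighbourhood \<open>U\<close> of the identity there is a
  finite \<open>F \<subseteq> G\<close> such that for all \<open>G\<close>-flows \<open>X\<close>, all almost periodic \<open>x \<in> X\<close>, all open \<open>V\<close>
  containing \<open>x\<close> and all \<open>g \<in> G\<close>, some \<open>k \<in> F\<close> takes \<open>g x\<close> into the closure of \<open>U V\<close>.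
  Almost periodicity of \<open>x\<close> alone gives such an \<open>F\<close> for each \<open>x\<close> and \<open>V\<close>; the point is that \<open>F\<close>
  depends on \<open>U\<close> only.

  Uniform recurrence gives CAP (\<open>CAP_on_if_uniformly_recurrent\<close>): choosing \<open>U\<close> and \<open>V\<close> with
  \<open>U V\<close> inside a small closed neighbourhood \<open>C\<close> of a limit \<open>x\<close> of almost periodic points,
  the return condition \<open>F (g x') \<inter> C \<noteq> {}\<close> passes from the points \<open>x'\<close> to their limit, and so
  every subflow of the orbit closure of \<open>x\<close> meets \<open>C\<close>.

  The converse is the heart of the matter.  Fix a continuous seminorm \<open>\<sigma>\<close> on the group with small
  unit ball (\<open>Birkhoff_Kakutani\<close>) and consider the compact flow \<open>L\<close> of \<open>[0,1]\<close>-valued functions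
  that are \<open>\<sigma>\<close>-Lipschitz, with the action by right translation.  Let \<open>M\<close> be a minimal left ideal
  of the Ellis semigroup of \<open>L\<close>, the closure of the translations in \<open>L\<^sup>L\<close>, and measure distances in
  \<open>M\<close> by \<open>D(y, x) = sup \<bar>(y f)(1) - (x f)(1)\<bar>\<close>, the supremum being over all \<open>f \<in> L\<close>.
  Such a supremum is in general only lower semicontinuous.  However, the function
  \<open>r(h) = D(h x, x)\<close> lies in \<open>L\<close> and is a pointwise limit of suprema over finite sets of \<open>f\<close>, which
  depend continuously on \<open>x\<close>; so CAP makes the pair \<open>(x, r)\<close> almost periodic.  An idempotent
  \<open>u \<in> M\<close> fixing this pair and some \<open>z \<in> M\<close> with \<open>x z = u\<close> turn \<open>r\<close> into the continuous function
  \<open>y \<mapsto> (y z r)(1)\<close> on \<open>M\<close>, which dominates \<open>D(y, x)\<close> and vanishes at \<open>x\<close>.  Hence \<open>M\<close> is totally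
  bounded for \<open>D\<close>, and minimality of \<open>M\<close> yields a finite set \<open>F\<close> of return times that serves all
  almost periodic \<open>f \<in> L\<close> at once, since each of them has the form \<open>m f\<close> with \<open>m \<in> M\<close>
  (\<open>CAP_uniformly_recurrent\<close>).  An arbitrary flow is compared with \<open>L\<close> through the
  truncated distance to the set of return times of a point (\<open>recurrence_from_quotient\<close>); this
  comparison also works for flows of \<open>G\<close> and functions on a quotient \<open>K\<close>, with \<open>U V\<close>
  replaced by \<open>U H V\<close>.

  Finally let \<open>x\<close> be almost periodic in a \<open>G\<close>-flow and \<open>N\<close> an open set containing \<open>x\<close>.  As \<open>H\<close> is
  normal and CAP, every point of \<open>G x\<close> is almost periodic for \<open>H\<close>
  (\<open>AP_subset_AP_normal_subgroup\<close>), so a finite \<open>F\<^sub>H \<subseteq> H\<close> returns each point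
  of \<open>H (N \<inter> G x)\<close> to the closure of \<open>U\<^sub>0 N\<close>, where \<open>U\<^sub>0 U\<^sub>0 \<subseteq> U\<close>.  Only afterwards a neighbourhood \<open>V\<close> of the identity is chosen, so
  small that \<open>f V inv f \<subseteq> U\<^sub>0\<close> for all \<open>f \<in> F\<^sub>H\<close>; applied to \<open>\<pi>(V)\<close>, the uniform recurrence of \<open>K\<close>
  returns \<open>g x\<close> to the closure of \<open>V H (N \<inter> G x)\<close> by a finite set.  Composing both returns gives uniform
  recurrence of \<open>G\<close>.
\<close>

section \<open>Flows and minimal subflows\<close>

text \<open>The form of Zorn's lemma behind both minimal subflows and idempotents: compactness
  keeps the intersection of a chain non-empty, so the family only has to be stable under
  non-empty intersections.\<close>

lemma minimal_closed_set:
  assumes comp: "compact_space X" and Y0: "Y0 \<in> \<A>"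
    and cl: "\<forall>Y\<in>\<A>. closedin X Y \<and> Y \<noteq> {}"
    and inter: "\<forall>\<C>. \<C> \<noteq> {} \<longrightarrow> \<C> \<subseteq> \<A> \<longrightarrow> \<Inter>\<C> \<noteq> {} \<longrightarrow> \<Inter>\<C> \<in> \<A>"
  shows "\<exists>M\<in>\<A>. M \<subseteq> Y0 \<and> (\<forall>Y\<in>\<A>. Y \<subseteq> M \<longrightarrow> Y = M)"
proof -
  define \<B> where "\<B> = {Y \<in> \<A>. Y \<subseteq> Y0}"
  define P where "P = (\<lambda>A B :: 'a set. B \<subseteq> A)"
  have "partial_order_on \<B> (relation_of P \<B>)"
    by (rule partial_order_on_relation_ofI) (auto simp: P_def)
  moreover have "\<exists>u\<in>\<B>. \<forall>a\<in>\<C>. P a u" if \<C>: "\<C> \<in> Chains (relation_of P \<B>)" for \<C>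
  proof (cases "\<C> = {}")
    case True
    then show ?thesis using Y0 by (auto simp: \<B>_def)
  next
    case False
    have sub: "\<C> \<subseteq> \<B>" and chain: "subset.chain \<B> \<C>"
      using \<C> by (auto simp: Chains_def relation_of_def P_def subset_chain_def)
    have "\<Inter>\<F> \<noteq> {}" if "finite \<F>" "\<F> \<subseteq> \<C>" for \<F>
    proof (cases "\<F> = {}")
      case nonempty: False
      have "subset.chain \<B> \<F>"
        using chain that(2) unfolding subset_chain_def by (meson subset_iff)
      then have "\<Inter>\<F> \<in> \<F>" using Inter_in_chain that(1) nonempty by blast
      then show ?thesis using that(2) sub cl by (auto simp: \<B>_def)
    qed simp
    moreover have "\<forall>C\<in>\<C>. closedin X C" using sub cl by (auto simp: \<B>_def)
    ultimately have "\<Inter>\<C> \<noteq> {}"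
      using comp[unfolded compact_space_fip, rule_format, of \<C>] by simp
    then have "\<Inter>\<C> \<in> \<A>" using inter False sub by (auto simp: \<B>_def)
    then have "\<Inter>\<C> \<in> \<B>" using False sub by (auto simp: \<B>_def)
    then show ?thesis by (auto simp: P_def)
  qed
  ultimately obtain M where M: "M \<in> \<B>" "\<forall>Y\<in>\<B>. P M Y \<longrightarrow> Y = M"
    using predicate_Zorn by metis
  moreover have "Y = M" if "Y \<in> \<A>" "Y \<subseteq> M" for Y
    using M that unfolding \<B>_def P_def by (metis (no_types, lifting) mem_Collect_eq subset_trans)
  ultimately show ?thesis unfolding \<B>_def by (intro bexI[of _ M]) simp_all
qed

lemma subflow_closed: "subflow G X \<phi> Y \<Longrightarrow> g \<in> carrier G \<Longrightarrow> y \<in> Y \<Longrightarrow> \<phi> g y \<in> Y"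
  by (auto simp: subflow_def)

locale group_flow =
  fixes G :: "('g, 'm) monoid_scheme" (structure) and T :: "'g topology"
    and X :: "'x topology" and \<phi> :: "'g \<Rightarrow> 'x \<Rightarrow> 'x"
  assumes tg: "topological_group G T" and fl: "flow G T X \<phi>"
begin

lemma is_group: "group G" and topT: "topspace T = carrier G"
  using tg by (simp_all add: topological_group_def)

lemma compact: "compact_space X" and Hausdorff: "Hausdorff_space X"
  and nonempty: "topspace X \<noteq> {}" and is_action: "group_action G (topspace X) \<phi>"
  and cont: "continuous_map (prod_topology T X) X (\<lambda>(g, x). \<phi> g x)"
  using fl by (auto simp: flow_def)

sublocale group G by (rule is_group)

lemma act_closed [simp, intro]: "g \<in> carrier G \<Longrightarrow> x \<in> topspace X \<Longrightarrow> \<phi> g x \<in> topspace X"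
  using is_action group_action.element_image by fastforce

lemma act_one [simp]: "x \<in> topspace X \<Longrightarrow> \<phi> \<one> x = x"
  using group_action.id_eq_one[OF is_action] by (metis restrict_apply')

lemma act_mult: "g \<in> carrier G \<Longrightarrow> h \<in> carrier G \<Longrightarrow> x \<in> topspace X \<Longrightarrow> \<phi> (g \<otimes> h) x = \<phi> g (\<phi> h x)"
  using group_action.composition_rule[OF is_action] by blast

lemma act_inv [simp]: "g \<in> carrier G \<Longrightarrow> x \<in> topspace X \<Longrightarrow> \<phi> (inv g) (\<phi> g x) = x"
  "g \<in> carrier G \<Longrightarrow> x \<in> topspace X \<Longrightarrow> \<phi> g (\<phi> (inv g) x) = x"
  by (metis act_mult act_one inv_closed l_inv, metis act_mult act_one inv_closed r_inv)

lemma act_ext: "g \<in> carrier G \<Longrightarrow> \<phi> g \<in> extensional (topspace X)"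
  using is_action unfolding group_action_def group_hom_def group_hom_axioms_def hom_def BijGroup_def Bij_def
  by auto

lemma cont_act: "g \<in> carrier G \<Longrightarrow> continuous_map X X (\<phi> g)"
proof -
  assume "g \<in> carrier G"
  then have "continuous_map X (prod_topology T X) (\<lambda>x. (g, x))"
    using topT by (intro continuous_map_pairedI) auto
  from continuous_map_compose[OF this cont] show ?thesis by (simp add: o_def)
qed

lemma orbit_subset: "x \<in> topspace X \<Longrightarrow> orbit G \<phi> x \<subseteq> topspace X"
  by (auto simp: orbit_def)

lemma orbit_closure_subflow: "x \<in> topspace X \<Longrightarrow> subflow G X \<phi> (X closure_of (orbit G \<phi> x))"
  and in_orbit_closure: "x \<in> topspace X \<Longrightarrow> x \<in> X closure_of (orbit G \<phi> x)"
  using subflow_orbit_closure[OF fl topT] by auto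

lemma orbit_closure_least:
  assumes "subflow G X \<phi> Y" "x \<in> Y"
  shows "X closure_of (orbit G \<phi> x) \<subseteq> Y"
  using assms by (intro closure_of_minimal) (auto simp: subflow_def orbit_def)

text \<open>A closed condition on an orbit closure may be checked on the orbit.  This replaces
  arguments with nets throughout.\<close>

lemma orbit_closure_induct:
  assumes "y \<in> X closure_of (orbit G \<phi> x)" and "x \<in> topspace X"
    and "closedin X C" and "\<And>g. g \<in> carrier G \<Longrightarrow> \<phi> g x \<in> C"
  shows "y \<in> C"
  using closure_of_minimal[of "orbit G \<phi> x" C X] assms by (auto simp: orbit_def)

lemma closedin_translate: "g \<in> carrier G \<Longrightarrow> closedin X C \<Longrightarrow> closedin X {y \<in> topspace X. \<phi> g y \<in> C}"
  using cont_act closedin_continuous_map_preimage by fastforce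

lemma openin_translate: "g \<in> carrier G \<Longrightarrow> openin X U \<Longrightarrow> openin X {y \<in> topspace X. \<phi> g y \<in> U}"
  using cont_act openin_continuous_map_preimage by fastforce

definition minimal_subflow :: "'x set \<Rightarrow> bool" where
  "minimal_subflow M \<longleftrightarrow> subflow G X \<phi> M \<and> (\<forall>Y. subflow G X \<phi> Y \<longrightarrow> Y \<subseteq> M \<longrightarrow> Y = M)"

lemma subflow_subset: "subflow G X \<phi> Y \<Longrightarrow> Y \<subseteq> topspace X"
  by (simp add: subflow_def closedin_subset)

lemma ex_minimal_subflow:
  assumes "subflow G X \<phi> Y"
  obtains M where "minimal_subflow M" "M \<subseteq> Y"
proof -
  let ?\<A> = "{Y. subflow G X \<phi> Y}"
  have cl: "\<forall>Z\<in>?\<A>. closedin X Z \<and> Z \<noteq> {}" by (simp add: subflow_def)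
  have inter: "\<Inter>\<C> \<in> ?\<A>" if "\<C> \<noteq> {}" "\<C> \<subseteq> ?\<A>" "\<Inter>\<C> \<noteq> {}" for \<C>
  proof -
    have "closedin X (\<Inter>\<C>)" using that by (auto simp: subflow_def intro!: closedin_Inter)
    moreover have "\<phi> g y \<in> \<Inter>\<C>" if g: "g \<in> carrier G" and y: "y \<in> \<Inter>\<C>" for g y
    proof
      fix C assume C: "C \<in> \<C>"
      then have "subflow G X \<phi> C" using \<open>\<C> \<subseteq> ?\<A>\<close> by blast
      then show "\<phi> g y \<in> C" using subflow_closed g y C by fastforce
    qed
    ultimately show ?thesis using that(3) unfolding subflow_def by blast
  qed
  have "Y \<in> ?\<A>" using assms by simp
  from minimal_closed_set[OF compact this cl] inter obtain M
    where M: "M \<in> ?\<A>" "M \<subseteq> Y" "\<forall>Z\<in>?\<A>. Z \<subseteq> M \<longrightarrow> Z = M"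
    by blast
  then have "minimal_subflow M" by (simp add: minimal_subflow_def)
  then show ?thesis using M(2) by (rule that)
qed

lemma minimal_subflow_orbit_closure:
  assumes "minimal_subflow M" "y \<in> M"
  shows "X closure_of (orbit G \<phi> y) = M"
proof -
  have M: "subflow G X \<phi> M" using assms by (simp add: minimal_subflow_def)
  then have "y \<in> topspace X" using assms(2) subflow_subset by blast
  then have "subflow G X \<phi> (X closure_of (orbit G \<phi> y))" by (rule orbit_closure_subflow)
  moreover have "X closure_of (orbit G \<phi> y) \<subseteq> M" using M assms(2) by (rule orbit_closure_least)
  ultimately show ?thesis using assms(1) by (simp add: minimal_subflow_def)
qed

text \<open>Orbit closures disappear from the description of almost periodicity, because a minimal
  subflow is the orbit closure of each of its points.\<close>

lemma AP_minimal: "x \<in> AP G T X \<phi> \<longleftrightarrow> (\<exists>M. minimal_subflow M \<and> x \<in> M)"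
proof
  assume "x \<in> AP G T X \<phi>"
  then have "x \<in> topspace X" "minimal_subflow (X closure_of (orbit G \<phi> x))"
    using AP_iff[OF fl topT] orbit_closure_subflow by (auto simp: minimal_subflow_def)
  then show "\<exists>M. minimal_subflow M \<and> x \<in> M" using in_orbit_closure by blast
next
  assume "\<exists>M. minimal_subflow M \<and> x \<in> M"
  then obtain M where M: "minimal_subflow M" "x \<in> M" by blast
  have "x \<in> topspace X" using M subflow_subset by (auto simp: minimal_subflow_def)
  then show "x \<in> AP G T X \<phi>"
    using M(1) by (simp add: AP_iff[OF fl topT] minimal_subflow_orbit_closure[OF M] minimal_subflow_def)
qed

lemma AP_subset: "AP G T X \<phi> \<subseteq> topspace X"
  by (auto simp: AP_def)

lemma AP_orbit_closure: "x \<in> AP G T X \<phi> \<Longrightarrow> minimal_subflow (X closure_of (orbit G \<phi> x))"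
  using AP_minimal minimal_subflow_orbit_closure by metis

text \<open>Every orbit in a minimal subflow meets every open set that the subflow meets, so the
  translates of that open set cover; compactness leaves finitely many.\<close>

lemma minimal_subflow_syndetic:
  assumes M: "minimal_subflow M" and N: "openin X N" "N \<inter> M \<noteq> {}"
  obtains F where "finite F" "F \<subseteq> carrier G" "\<And>y. y \<in> M \<Longrightarrow> \<exists>f\<in>F. \<phi> f y \<in> N"
proof -
  let ?V = "\<lambda>g. {y \<in> topspace X. \<phi> g y \<in> N}"
  have sM: "subflow G X \<phi> M" using M by (simp add: minimal_subflow_def)
  have "compactin X M"
    using sM compact closedin_compact_space by (auto simp: subflow_def)
  moreover have "M \<subseteq> (\<Union>g\<in>carrier G. ?V g)"
  proof
    fix y assume y: "y \<in> M"
    then have "X closure_of (orbit G \<phi> y) \<inter> N \<noteq> {}"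
      using minimal_subflow_orbit_closure[OF M] N by blast
    then have "orbit G \<phi> y \<inter> N \<noteq> {}"
      using N(1) openin_Int_closure_of_eq_empty by blast
    then show "y \<in> (\<Union>g\<in>carrier G. ?V g)"
      using y subflow_subset[OF sM] by (auto simp: orbit_def)
  qed
  moreover have "\<forall>U\<in>?V ` carrier G. openin X U" using openin_translate[OF _ N(1)] by blast
  ultimately obtain \<F> where \<F>: "finite \<F>" "\<F> \<subseteq> ?V ` carrier G" "M \<subseteq> \<Union>\<F>"
    unfolding compactin_def by meson
  then obtain F where "F \<subseteq> carrier G" "finite F" "\<F> = ?V ` F"
    using finite_subset_image[OF \<F>(1,2)] by auto
  with \<F>(3) show ?thesis by (intro that[of F]) auto
qed

end

lemma group_flowI:
  assumes tg: "topological_group G T"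
    and "topspace X \<noteq> {}" "compact_space X" "Hausdorff_space X"
    and "\<And>g. g \<in> carrier G \<Longrightarrow> \<phi> g \<in> extensional (topspace X)"
    and "\<And>g x. g \<in> carrier G \<Longrightarrow> x \<in> topspace X \<Longrightarrow> \<phi> g x \<in> topspace X"
    and "\<And>x. x \<in> topspace X \<Longrightarrow> \<phi> \<one>\<^bsub>G\<^esub> x = x"
    and "\<And>g h x. g \<in> carrier G \<Longrightarrow> h \<in> carrier G \<Longrightarrow> x \<in> topspace X \<Longrightarrow>
           \<phi> (g \<otimes>\<^bsub>G\<^esub> h) x = \<phi> g (\<phi> h x)"
    and "continuous_map (prod_topology T X) X (\<lambda>(g, x). \<phi> g x)"
  shows "group_flow G T X \<phi>"
proof -
  have "group G" using tg by (simp add: topological_group_def)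
  then have "group_action G (topspace X) \<phi>" using assms by (intro group_actionI) auto
  then show ?thesis using assms by (simp add: group_flow_def flow_def)
qed

lemma subflow_image:
  assumes "group_flow G T X \<phi>" "group_flow G T Z \<psi>"
    and \<theta>: "continuous_map X Z \<theta>"
    and eq: "\<And>g y. g \<in> carrier G \<Longrightarrow> y \<in> Y \<Longrightarrow> \<theta> (\<phi> g y) = \<psi> g (\<theta> y)"
    and Y: "subflow G X \<phi> Y"
  shows "subflow G Z \<psi> (\<theta> ` Y)"
proof -
  interpret X: group_flow G T X \<phi> by fact
  interpret Z: group_flow G T Z \<psi> by fact
  have "closedin Z (\<theta> ` Y)"
    using T1_Spaces.continuous_imp_closed_map[OF \<theta> X.compact Z.Hausdorff] Y
    by (simp add: closed_map_def subflow_def)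
  moreover have "\<psi> g ` \<theta> ` Y \<subseteq> \<theta> ` Y" if "g \<in> carrier G" for g
    using that Y eq by (force simp: subflow_def)
  ultimately show ?thesis using Y by (simp add: subflow_def)
qed

lemma subflow_vimage:
  assumes "group_flow G T X \<phi>"
    and \<theta>: "continuous_map X Z \<theta>"
    and eq: "\<And>g y. g \<in> carrier G \<Longrightarrow> y \<in> Y \<Longrightarrow> \<theta> (\<phi> g y) = \<psi> g (\<theta> y)"
    and Y: "subflow G X \<phi> Y" and W: "subflow G Z \<psi> W" and ne: "\<theta> ` Y \<inter> W \<noteq> {}"
  shows "subflow G X \<phi> {y \<in> Y. \<theta> y \<in> W}"
proof -
  interpret X: group_flow G T X \<phi> by fact
  have "closedin X (Y \<inter> {y \<in> topspace X. \<theta> y \<in> W})"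
    using Y W closedin_continuous_map_preimage[OF \<theta>] by (auto simp: subflow_def)
  moreover have "Y \<inter> {y \<in> topspace X. \<theta> y \<in> W} = {y \<in> Y. \<theta> y \<in> W}"
    using X.subflow_subset[OF Y] by blast
  moreover have "\<phi> g ` {y \<in> Y. \<theta> y \<in> W} \<subseteq> {y \<in> Y. \<theta> y \<in> W}" if g: "g \<in> carrier G" for g
  proof clarify
    fix y assume "y \<in> Y" "\<theta> y \<in> W"
    then show "\<phi> g y \<in> Y \<and> \<theta> (\<phi> g y) \<in> W"
      using g eq[OF g] subflow_closed[OF Y g] subflow_closed[OF W g] by simp
  qed
  ultimately show ?thesis using ne by (auto simp: subflow_def)
qed

text \<open>The preimage of a smaller subflow of the image would be a smaller subflow of \<open>M\<close>.\<close>

lemma minimal_subflow_image: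
  assumes "group_flow G T X \<phi>" "group_flow G T Z \<psi>"
    and \<theta>: "continuous_map X Z \<theta>"
    and eq: "\<And>g y. g \<in> carrier G \<Longrightarrow> y \<in> M \<Longrightarrow> \<theta> (\<phi> g y) = \<psi> g (\<theta> y)"
    and M: "group_flow.minimal_subflow G X \<phi> M"
  shows "group_flow.minimal_subflow G Z \<psi> (\<theta> ` M)"
proof -
  interpret X: group_flow G T X \<phi> by fact
  interpret Z: group_flow G T Z \<psi> by fact
  have sM: "subflow G X \<phi> M" using M by (simp add: X.minimal_subflow_def)
  have "W = \<theta> ` M" if W: "subflow G Z \<psi> W" "W \<subseteq> \<theta> ` M" for W
  proof -
    have "\<theta> ` M \<inter> W \<noteq> {}" using W by (auto simp: subflow_def)
    then have "subflow G X \<phi> {y \<in> M. \<theta> y \<in> W}"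
      using subflow_vimage[OF assms(1) \<theta>, of M \<psi> W] eq sM W(1) by blast
    then have "{y \<in> M. \<theta> y \<in> W} = M" using M unfolding X.minimal_subflow_def by blast
    then show ?thesis using W(2) by blast
  qed
  then show ?thesis
    using subflow_image[OF assms(1,2) \<theta>, of M] eq sM by (simp add: Z.minimal_subflow_def)
qed

lemma group_flow_prod:
  assumes "group_flow G T X \<phi>" "group_flow G T Z \<psi>"
  shows "group_flow G T (prod_topology X Z)
    (\<lambda>g. \<lambda>(x, z)\<in>topspace X \<times> topspace Z. (\<phi> g x, \<psi> g z))"
proof -
  interpret X: group_flow G T X \<phi> by fact
  interpret Z: group_flow G T Z \<psi> by fact
  let ?P = "prod_topology T (prod_topology X Z)"
  have 1: "continuous_map ?P (prod_topology T X) (\<lambda>(g, x, z). (g, x))"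
    and 2: "continuous_map ?P (prod_topology T Z) (\<lambda>(g, x, z). (g, z))"
    by (auto simp: case_prod_unfold intro!: continuous_map_pairedI continuous_map_fst
        continuous_map_fst_of[unfolded o_def] continuous_map_snd_of[unfolded o_def] continuous_map_compose[OF continuous_map_snd, unfolded o_def])
  have "continuous_map ?P (prod_topology X Z) (\<lambda>(g, x, z). (\<phi> g x, \<psi> g z))"
    using continuous_map_compose[OF 1 X.cont] continuous_map_compose[OF 2 Z.cont]
    by (simp add: o_def case_prod_unfold continuous_map_pairedI)
  then have "continuous_map ?P (prod_topology X Z)
      (\<lambda>(g, xz). (\<lambda>(x, z)\<in>topspace X \<times> topspace Z. (\<phi> g x, \<psi> g z)) xz)"
    by (rule continuous_map_eq) auto
  then show ?thesis
    using X.tg X.nonempty Z.nonempty X.compact Z.compact X.Hausdorff Z.Hausdorff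
    by (intro group_flowI)
       (auto simp: compact_space_prod_topology Hausdorff_space_prod_topology X.act_mult Z.act_mult)
qed

lemma group_flow_power:
  assumes "group_flow G T X \<phi>"
  shows "group_flow G T (product_topology (\<lambda>_. X) I)
    (\<lambda>g. \<lambda>q\<in>I \<rightarrow>\<^sub>E topspace X. \<lambda>i\<in>I. \<phi> g (q i))"
proof -
  interpret X: group_flow G T X \<phi> by fact
  let ?E = "product_topology (\<lambda>_. X) I"
  have "continuous_map (prod_topology T ?E) X (\<lambda>(g, q). \<phi> g (q i))" if i: "i \<in> I" for i
  proof -
    have "continuous_map ?E X (\<lambda>q. q i)"
      using i by (rule continuous_map_product_projection)
    then have "continuous_map (prod_topology T ?E) (prod_topology T X) (\<lambda>(g, q). (g, q i))"
      by (auto simp: case_prod_unfold intro!: continuous_map_pairedI continuous_map_fst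
        continuous_map_fst_of[unfolded o_def] continuous_map_snd_of[unfolded o_def] continuous_map_compose[OF continuous_map_snd, unfolded o_def])
    from continuous_map_compose[OF this X.cont] show ?thesis
      by (simp add: o_def case_prod_unfold)
  qed
  then have "continuous_map (prod_topology T ?E) ?E (\<lambda>(g, q). \<lambda>i\<in>I. \<phi> g (q i))"
    by (auto simp: continuous_map_componentwise case_prod_unfold)
  then have "continuous_map (prod_topology T ?E) ?E (\<lambda>(g, q). (\<lambda>q\<in>I \<rightarrow>\<^sub>E topspace X. \<lambda>i\<in>I. \<phi> g (q i)) q)"
    by (rule continuous_map_eq) auto
  moreover have "compact_space ?E" "Hausdorff_space ?E"
    using X.compact X.Hausdorff by (simp_all add: compact_space_product_topology Hausdorff_space_product_topology)
  moreover have "(\<lambda>i\<in>I. \<phi> \<one>\<^bsub>G\<^esub> (q i)) = q" if "q \<in> I \<rightarrow>\<^sub>E topspace X" for q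
    by (rule extensionalityI[of _ I]) (use that in \<open>auto simp: PiE_iff\<close>)
  moreover have "(\<lambda>i\<in>I. \<phi> (g \<otimes>\<^bsub>G\<^esub> h) (q i)) = (\<lambda>i\<in>I. \<phi> g ((\<lambda>i\<in>I. \<phi> h (q i)) i))"
    if "g \<in> carrier G" "h \<in> carrier G" "q \<in> I \<rightarrow>\<^sub>E topspace X" for g h q
    by (rule restrict_ext) (use that in \<open>auto simp: PiE_iff X.act_mult\<close>)
  moreover have "(\<lambda>i\<in>I. \<phi> g (q i)) \<in> I \<rightarrow>\<^sub>E topspace X" if "g \<in> carrier G" "q \<in> I \<rightarrow>\<^sub>E topspace X" for g q
    using that by (auto simp: PiE_iff)
  ultimately show ?thesis
    using X.tg X.nonempty
  proof (intro group_flowI, goal_cases)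
    case 2
    then show ?case by (simp add: PiE_eq_empty_iff)
  qed (simp_all del: split_paired_All)
qed

section \<open>Continuous seminorms on topological groups\<close>

lemma topological_group_translations:
  assumes tg: "topological_group G T" and a: "a \<in> carrier G"
  shows "continuous_map T T (\<lambda>x. a \<otimes>\<^bsub>G\<^esub> x)" "continuous_map T T (\<lambda>x. x \<otimes>\<^bsub>G\<^esub> a)"
proof -
  have m: "continuous_map (prod_topology T T) T (\<lambda>(g, h). g \<otimes>\<^bsub>G\<^esub> h)" and top: "topspace T = carrier G"
    using tg by (simp_all add: topological_group_def)
  have 1: "continuous_map T (prod_topology T T) (\<lambda>x. (a, x))"
    and 2: "continuous_map T (prod_topology T T) (\<lambda>x. (x, a))"
    using a top by (simp_all add: continuous_map_pairedI)
  show "continuous_map T T (\<lambda>x. a \<otimes>\<^bsub>G\<^esub> x)" "continuous_map T T (\<lambda>x. x \<otimes>\<^bsub>G\<^esub> a)"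
    using continuous_map_compose[OF 1 m] continuous_map_compose[OF 2 m] by (simp_all add: o_def)
qed

lemma topological_group_nbhd_mult:
  fixes G :: "('g, 'm) monoid_scheme" (structure)
  assumes tg: "topological_group G T" and U: "openin T U" "\<one>\<^bsub>G\<^esub> \<in> U"
  obtains V where "openin T V" "\<one>\<^bsub>G\<^esub> \<in> V" "V \<subseteq> U" "\<And>a b. a \<in> V \<Longrightarrow> b \<in> V \<Longrightarrow> a \<otimes>\<^bsub>G\<^esub> b \<in> U"
proof -
  interpret group G using tg by (simp add: topological_group_def)
  have m: "continuous_map (prod_topology T T) T (\<lambda>(g, h). g \<otimes>\<^bsub>G\<^esub> h)" and top: "topspace T = carrier G"
    using tg by (simp_all add: topological_group_def)
  let ?S = "{p \<in> topspace (prod_topology T T). (\<lambda>(g, h). g \<otimes> h) p \<in> U}"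
  have "openin (prod_topology T T) ?S"
    using openin_continuous_map_preimage[OF m U(1)] .
  moreover have "(\<one>, \<one>) \<in> ?S" using U top by simp
  ultimately obtain A B where AB: "openin T A" "openin T B" "\<one> \<in> A" "\<one> \<in> B" "A \<times> B \<subseteq> ?S"
    unfolding openin_prod_topology_alt by meson
  have "a \<otimes> b \<in> U" if "a \<in> A \<inter> B \<inter> U" "b \<in> A \<inter> B \<inter> U" for a b
    using AB(5) that by auto
  then show ?thesis using AB U by (intro that[of "A \<inter> B \<inter> U"]) auto
qed

text \<open>Unlike for a norm on a group, \<open>\<sigma>\<close> may vanish outside the identity.  Continuity at the identity
  is the last conjunct, and subadditivity spreads it over the group.\<close>

definition group_seminorm :: "('g, 'm) monoid_scheme \<Rightarrow> 'g topology \<Rightarrow> ('g \<Rightarrow> real) \<Rightarrow> bool" where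
  "group_seminorm G T \<sigma> \<longleftrightarrow>
     (\<forall>g\<in>carrier G. 0 \<le> \<sigma> g \<and> \<sigma> (inv\<^bsub>G\<^esub> g) = \<sigma> g) \<and>
     (\<forall>g\<in>carrier G. \<forall>h\<in>carrier G. \<sigma> (g \<otimes>\<^bsub>G\<^esub> h) \<le> \<sigma> g + \<sigma> h) \<and>
     (\<forall>e>0. \<exists>U. openin T U \<and> \<one>\<^bsub>G\<^esub> \<in> U \<and> (\<forall>g\<in>U. \<sigma> g < e))"

lemma group_seminorm_one: "group G \<Longrightarrow> group_seminorm G T \<sigma> \<Longrightarrow> \<sigma> \<one>\<^bsub>G\<^esub> = 0"
  unfolding group_seminorm_def
  by (metis group.is_monoid monoid.one_closed order_le_less field_lbound_gt_zero linorder_neq_iff order_less_asym)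

text \<open>A list can be cut around a single entry so that the part before it weighs at most \<open>t\<close> and the
  part after it at most the rest; for \<open>t\<close> half of the total this drives the dyadic induction below.\<close>

lemma split_list_weight:
  fixes w :: "'a \<Rightarrow> real"
  assumes "\<And>x. 0 \<le> w x" and "xs \<noteq> []" and "0 \<le> t"
  shows "\<exists>as c bs. xs = as @ c # bs \<and> sum_list (map w as) \<le> t \<and>
     sum_list (map w bs) \<le> max 0 (sum_list (map w xs) - t)"
  using assms(2,3)
proof (induction xs arbitrary: t)
  case (Cons x xs)
  show ?case
  proof (cases "t \<le> w x \<or> xs = []")
    case True
    then show ?thesis using Cons.prems by (intro exI[of _ "[]"] exI[of _ x] exI[of _ xs]) auto
  next
    case False
    then have "xs \<noteq> []" "0 \<le> t - w x" by auto
    from Cons.IH[OF this] obtain as c bs where "xs = as @ c # bs" "sum_list (map w as) \<le> t - w x"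
      "sum_list (map w bs) \<le> max 0 (sum_list (map w xs) - (t - w x))"
      by blast
    then show ?thesis
      by (intro exI[of _ "x # as"] exI[of _ c] exI[of _ bs]) (auto simp: algebra_simps)
  qed
qed simp

text \<open>Neighbourhoods \<open>V n\<close> with \<open>V (n+1)^3 \<subseteq> V n\<close> give each element a dyadic weight, and the
  seminorm is the least total weight of a factorisation.  The induction \<open>chain\<close> shows that passing to
  factorisations loses nothing essential: a product of total weight below \<open>(1/2)^n\<close>
  stays in \<open>V n\<close>, because it is a product of three factors from \<open>V (n+1)\<close>, namely one entry and
  two products of at most half the weight.\<close>

theorem Birkhoff_Kakutani:
  fixes G :: "('g, 'm) monoid_scheme" (structure)
  assumes tg: "topological_group G T" and U: "openin T U" "\<one>\<^bsub>G\<^esub> \<in> U"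
  obtains \<sigma> where "group_seminorm G T \<sigma>" "\<And>g. g \<in> carrier G \<Longrightarrow> \<sigma> g < 1 \<Longrightarrow> g \<in> U"
proof -
  interpret group G using tg by (simp add: topological_group_def)
  have top: "topspace T = carrier G" and invc: "continuous_map T T (\<lambda>g. inv g)"
    using tg by (simp_all add: topological_group_def)
  have "\<exists>V. openin T V \<and> \<one> \<in> V \<and> V \<subseteq> U \<inter> W \<and> (\<forall>a\<in>V. \<forall>b\<in>V. \<forall>c\<in>V. a \<otimes> b \<otimes> c \<in> W)"
    if W: "openin T W" "\<one> \<in> W" for W
  proof -
    obtain V where V: "openin T V" "\<one> \<in> V" "V \<subseteq> W" "\<And>a b. a \<in> V \<Longrightarrow> b \<in> V \<Longrightarrow> a \<otimes> b \<in> W"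
      using topological_group_nbhd_mult[OF tg W] by metis
    obtain V' where V': "openin T V'" "\<one> \<in> V'" "V' \<subseteq> V" "\<And>a b. a \<in> V' \<Longrightarrow> b \<in> V' \<Longrightarrow> a \<otimes> b \<in> V"
      using topological_group_nbhd_mult[OF tg V(1,2)] by metis
    then show ?thesis using V U by (intro exI[of _ "V' \<inter> U"]) auto
  qed
  then obtain nx where nx: "\<And>W. openin T W \<Longrightarrow> \<one> \<in> W \<Longrightarrow> openin T (nx W) \<and> \<one> \<in> nx W \<and> nx W \<subseteq> U \<inter> W \<and>
      (\<forall>a\<in>nx W. \<forall>b\<in>nx W. \<forall>c\<in>nx W. a \<otimes> b \<otimes> c \<in> W)"
    by metis
  define V where "V = rec_nat (carrier G) (\<lambda>_. nx)"
  have V0: "V 0 = carrier G" and VS: "V (Suc n) = nx (V n)" for n by (simp_all add: V_def)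
  have Vop: "openin T (V n) \<and> \<one> \<in> V n" for n
    by (induction n) (use nx openin_topspace[of T] in \<open>auto simp: V0 VS top\<close>)
  have Vsub: "V n \<subseteq> carrier G" for n using Vop openin_subset top by blast
  have cube: "a \<otimes> b \<otimes> c \<in> V n" if "a \<in> V (Suc n)" "b \<in> V (Suc n)" "c \<in> V (Suc n)" for a b c n
    using nx[of "V n"] Vop that by (auto simp: VS)
  have mono: "V n \<subseteq> V m" if "m \<le> n" for m n
    using that by (rule lift_Suc_antimono_le[rotated]) (use nx Vop in \<open>auto simp: VS\<close>)
  define w where "w g = (if g \<in> carrier G then Inf {(1/2::real) ^ n | n. g \<in> V n} else 0)" for g
  have bdd: "bdd_below {(1/2::real) ^ n | n. g \<in> V n}" for g
    by (rule bdd_belowI[of _ 0]) auto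
  have w0: "0 \<le> w g" for g
  proof (cases "g \<in> carrier G")
    case True
    then have "{(1/2::real) ^ n | n. g \<in> V n} \<noteq> {}" using V0 by blast
    then have "0 \<le> Inf {(1/2::real) ^ n | n. g \<in> V n}" by (rule cInf_greatest) auto
    then show ?thesis using True by (simp add: w_def)
  qed (simp add: w_def)
  have wle: "w g \<le> (1/2) ^ n" if "g \<in> V n" for g n
  proof -
    have "Inf {(1/2::real) ^ n | n. g \<in> V n} \<le> (1/2) ^ n"
      using that bdd by (intro cInf_lower) auto
    then show ?thesis using that Vsub by (auto simp: w_def)
  qed
  have wless: "g \<in> V (Suc n)" if "w g < (1/2) ^ n" "g \<in> carrier G" for g n
  proof -
    have ne: "{(1/2::real) ^ n | n. g \<in> V n} \<noteq> {}" using V0 that(2) by blast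
    have "Inf {(1/2::real) ^ n | n. g \<in> V n} < (1/2) ^ n"
      using that by (simp add: w_def)
    from cInf_lessD[OF ne this] obtain m where m: "g \<in> V m" "(1/2::real) ^ m < (1/2) ^ n"
      by auto
    moreover have "n < m" using m(2) by (simp add: power_strict_decreasing_iff)
    ultimately show ?thesis using mono[of "Suc n" m] by auto
  qed
  define P where "P xs = foldr (\<otimes>) xs \<one>" for xs
  have P_closed: "P xs \<in> carrier G" if "set xs \<subseteq> carrier G" for xs
    using that by (induction xs) (auto simp: P_def)
  have P_append: "P (xs @ ys) = P xs \<otimes> P ys" if "set xs \<subseteq> carrier G" "set ys \<subseteq> carrier G" for xs ys
    using that by (induction xs) (use P_closed in \<open>auto simp: P_def m_assoc\<close>)
  let ?w = "\<lambda>xs. sum_list (map w xs)"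
  \<comment> \<open>Both outer pieces carry at most half of the weight, hence lie in \<open>V (Suc n)\<close>; so does the entry between them.\<close>
  have chain: "P xs \<in> V n" if "set xs \<subseteq> carrier G" "?w xs < (1/2) ^ n" for xs n
    using that
  proof (induction "length xs" arbitrary: xs n rule: less_induct)
    case less
    show ?case
    proof (cases "xs = []")
      case True
      then show ?thesis using Vop by (simp add: P_def)
    next
      case False
      have nonneg: "0 \<le> ?w ys" for ys using w0 by (intro sum_list_nonneg) auto
      then have "0 \<le> ?w xs / 2" by simp
      from split_list_weight[of w xs "?w xs / 2", OF w0 False this] obtain as c bs
        where xs: "xs = as @ c # bs" and as: "?w as \<le> ?w xs / 2"
          and "?w bs \<le> max 0 (?w xs - ?w xs / 2)"
        by (elim exE conjE) (rule that)
      then have bs: "?w bs \<le> ?w xs / 2" using nonneg[of xs] by linarith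
      have c: "w c \<le> ?w xs" using nonneg[of as] nonneg[of bs] by (simp add: xs)
      have "P as \<in> V (Suc n)"
        using as less.prems by (intro less.hyps) (simp_all add: xs)
      moreover have "P bs \<in> V (Suc n)"
        using bs less.prems by (intro less.hyps) (simp_all add: xs)
      moreover have "c \<in> V (Suc n)" using c less.prems by (intro wless) (auto simp: xs)
      moreover have "P xs = P as \<otimes> c \<otimes> P bs"
        using less.prems P_append[of as "c # bs"] P_closed by (auto simp: xs P_def m_assoc)
      ultimately show ?thesis using cube by simp
    qed
  qed
  define N where "N g = {?w xs | xs. set xs \<subseteq> carrier G \<and> P xs = g}" for g
  have wN: "w g \<in> N g" if "g \<in> carrier G" for g
    using that unfolding N_def by (intro CollectI exI[of _ "[g]"]) (simp add: P_def)
  have N0: "0 \<le> r" if "r \<in> N g" for g r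
    using that w0 by (auto simp: N_def intro!: sum_list_nonneg)
  then have bddN: "bdd_below (N g)" for g by (meson bdd_belowI)
  define \<tau> where "\<tau> g = Inf (N g)" for g
  have \<tau>0: "0 \<le> \<tau> g" if "g \<in> carrier G" for g
    unfolding \<tau>_def using wN that N0 by (intro cInf_greatest) auto
  have \<tau>w: "\<tau> g \<le> w g" if "g \<in> carrier G" for g
    unfolding \<tau>_def using wN that bddN by (intro cInf_lower) auto
  have \<tau>add: "\<tau> (g \<otimes> h) \<le> \<tau> g + \<tau> h" if g: "g \<in> carrier G" and h: "h \<in> carrier G" for g h
  proof -
    have *: "\<tau> (g \<otimes> h) \<le> r + s" if "r \<in> N g" "s \<in> N h" for r s
    proof -
      obtain xs where xs: "r = ?w xs" "set xs \<subseteq> carrier G" "P xs = g"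
        using \<open>r \<in> N g\<close> unfolding N_def by blast
      obtain ys where ys: "s = ?w ys" "set ys \<subseteq> carrier G" "P ys = h"
        using \<open>s \<in> N h\<close> unfolding N_def by blast
      have "r + s \<in> N (g \<otimes> h)"
        unfolding N_def using xs ys by (intro CollectI exI[of _ "xs @ ys"]) (simp add: P_append)
      then show ?thesis unfolding \<tau>_def by (intro cInf_lower bddN)
    qed
    have "\<tau> (g \<otimes> h) - s \<le> \<tau> g" if s: "s \<in> N h" for s
      unfolding \<tau>_def[of g]
    proof (rule cInf_greatest)
      show "N g \<noteq> {}" using wN[OF g] by blast
      show "\<tau> (g \<otimes> h) - s \<le> r" if "r \<in> N g" for r using *[OF that s] by simp
    qed
    then have "\<tau> (g \<otimes> h) - \<tau> g \<le> \<tau> h"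
      unfolding \<tau>_def[of h] using wN[OF h] by (intro cInf_greatest) (auto simp: algebra_simps)
    then show ?thesis by simp
  qed
  \<comment> \<open>The maximum makes it symmetric; the factor 2 turns weight below 1/2, which forces membership in \<open>V 1\<close>, into \<open>\<sigma> g < 1\<close>.\<close>
  define \<sigma> where "\<sigma> g = 2 * max (\<tau> g) (\<tau> (inv g))" for g
  have "\<exists>U. openin T U \<and> \<one> \<in> U \<and> (\<forall>g\<in>U. \<sigma> g < e)" if e: "e > 0" for e
  proof -
    obtain n where n: "(1/2) ^ n < e / 2"
      using real_arch_pow_inv[of "e / 2" "1/2"] e by auto
    let ?U = "V n \<inter> {g \<in> topspace T. inv g \<in> V n}"
    have "openin T ?U"
      by (intro openin_Int openin_continuous_map_preimage[OF invc]) (simp_all add: Vop)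
    moreover have "\<one> \<in> ?U" using Vop top by simp
    moreover have "\<sigma> g < e" if "g \<in> ?U" for g
    proof -
      have "g \<in> carrier G" using that top by simp
      then have "\<tau> g \<le> (1/2) ^ n" "\<tau> (inv g) \<le> (1/2) ^ n"
        using that \<tau>w[of g] \<tau>w[of "inv g"] wle[of g n] wle[of "inv g" n] by simp_all
      then show ?thesis using n by (simp add: \<sigma>_def)
    qed
    ultimately show ?thesis by blast
  qed
  moreover have "0 \<le> \<sigma> g \<and> \<sigma> (inv g) = \<sigma> g" if "g \<in> carrier G" for g
    using that \<tau>0[of g] by (simp add: \<sigma>_def max.commute)
  moreover have "\<sigma> (g \<otimes> h) \<le> \<sigma> g + \<sigma> h" if "g \<in> carrier G" "h \<in> carrier G" for g h
    using that \<tau>add[of g h] \<tau>add[of "inv h" "inv g"] by (simp add: \<sigma>_def inv_mult_group max_def)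
  ultimately have "group_seminorm G T \<sigma>" by (simp add: group_seminorm_def)
  moreover have "g \<in> U" if "g \<in> carrier G" "\<sigma> g < 1" for g
  proof -
    have "N g \<noteq> {}" using wN that by blast
    moreover have "Inf (N g) < 1/2" using that by (simp add: \<sigma>_def flip: \<tau>_def)
    ultimately obtain xs where "set xs \<subseteq> carrier G" "P xs = g" "?w xs < 1/2"
      using cInf_lessD[of "N g" "1/2"] by (auto simp: N_def)
    then have "g \<in> V (Suc 0)" using chain[of xs "Suc 0"] by simp
    then show ?thesis using nx[of "V 0"] Vop[of 0] by (auto simp: VS)
  qed
  ultimately show ?thesis by (rule that)
qed

section \<open>The flow of Lipschitz functions\<close>

text \<open>The modulus \<open>\<sigma>\<close> controls left translation of the argument.  Right translation then acts on
  these functions, and the modulus makes this action jointly continuous for pointwise convergence.\<close>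

definition Lip :: "('g, 'm) monoid_scheme \<Rightarrow> ('g \<Rightarrow> real) \<Rightarrow> ('g \<Rightarrow> real) set" where
  "Lip G \<sigma> = {f \<in> carrier G \<rightarrow>\<^sub>E {0..1}.
     \<forall>g\<in>carrier G. \<forall>h\<in>carrier G. \<bar>f (g \<otimes>\<^bsub>G\<^esub> h) - f h\<bar> \<le> \<sigma> g}"

definition Lip_topology :: "('g, 'm) monoid_scheme \<Rightarrow> ('g \<Rightarrow> real) \<Rightarrow> ('g \<Rightarrow> real) topology" where
  "Lip_topology G \<sigma> = subtopology (product_topology (\<lambda>_. euclideanreal) (carrier G)) (Lip G \<sigma>)"

definition shift :: "('g, 'm) monoid_scheme \<Rightarrow> ('g \<Rightarrow> real) \<Rightarrow> 'g \<Rightarrow> ('g \<Rightarrow> real) \<Rightarrow> 'g \<Rightarrow> real" where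
  "shift G \<sigma> g = (\<lambda>f\<in>Lip G \<sigma>. \<lambda>h\<in>carrier G. f (h \<otimes>\<^bsub>G\<^esub> g))"

lemma topspace_Lip [simp]: "topspace (Lip_topology G \<sigma>) = Lip G \<sigma>"
  by (auto simp: Lip_topology_def Lip_def PiE_def)

lemma continuous_map_eval_Lip:
  "h \<in> carrier G \<Longrightarrow> continuous_map (Lip_topology G \<sigma>) euclideanreal (\<lambda>f. f h)"
  unfolding Lip_topology_def
  by (intro continuous_map_from_subtopology continuous_map_product_projection)

lemma continuous_map_into_Lip:
  "continuous_map X (Lip_topology G \<sigma>) F \<longleftrightarrow>
     F \<in> topspace X \<rightarrow> Lip G \<sigma> \<and> (\<forall>h\<in>carrier G. continuous_map X euclideanreal (\<lambda>x. F x h))"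
proof -
  have "F ` topspace X \<subseteq> extensional (carrier G)" if "F \<in> topspace X \<rightarrow> Lip G \<sigma>"
    using that by (auto simp: Lip_def PiE_def)
  then show ?thesis
    by (auto simp: Lip_topology_def continuous_map_in_subtopology continuous_map_componentwise image_subset_iff)
qed

lemma Lip_bounds: "f \<in> Lip G \<sigma> \<Longrightarrow> h \<in> carrier G \<Longrightarrow> 0 \<le> f h \<and> f h \<le> 1"
  by (auto simp: Lip_def PiE_iff)

lemma compact_Lip:
  assumes "group G"
  shows "compact_space (Lip_topology G \<sigma>)"
proof -
  interpret group G by fact
  let ?P = "product_topology (\<lambda>_. euclideanreal) (carrier G)"
  let ?B = "carrier G \<rightarrow>\<^sub>E {0..1::real}"
  let ?C = "\<lambda>(g, h). {f \<in> topspace ?P. \<bar>f (g \<otimes>\<^bsub>G\<^esub> h) - f h\<bar> \<in> {..\<sigma> g}}"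
  have "closedin ?P (?C p)" if pc: "p \<in> carrier G \<times> carrier G" for p
  proof -
    obtain g h where p: "p = (g, h)" "g \<in> carrier G" "h \<in> carrier G"
      using pc by auto
    then have "continuous_map ?P euclideanreal (\<lambda>f. \<bar>f (g \<otimes>\<^bsub>G\<^esub> h) - f h\<bar>)"
      by (intro continuous_map_real_abs continuous_map_diff continuous_map_product_projection) auto
    then have "closedin ?P {f \<in> topspace ?P. \<bar>f (g \<otimes>\<^bsub>G\<^esub> h) - f h\<bar> \<in> {..\<sigma> g}}"
      by (rule closedin_continuous_map_preimage) simp
    then show ?thesis using p by simp
  qed
  then have "closedin ?P (\<Inter>p\<in>carrier G \<times> carrier G. ?C p)" using one_closed by (intro closedin_INT) auto
  moreover have "compactin ?P ?B" by (simp add: compactin_PiE)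
  moreover have "Lip G \<sigma> = ?B \<inter> (\<Inter>p\<in>carrier G \<times> carrier G. ?C p)"
    using one_closed unfolding Lip_def PiE_def by (auto simp: extensional_def)
  ultimately have "compactin ?P (Lip G \<sigma>)"
    by (simp add: compact_Int_closedin)
  then show ?thesis by (simp add: Lip_topology_def compact_space_subtopology)
qed

text \<open>Joint continuity at \<open>(g\<^sub>0, f\<^sub>0)\<close> rests on writing
  \<open>h g = (h g inv g\<^sub>0 inv h) (h g\<^sub>0)\<close>: for fixed \<open>h\<close> the first factor tends to the identity as \<open>g\<close>
  tends to \<open>g\<^sub>0\<close>, and the Lipschitz condition bounds its effect uniformly in \<open>f\<close>.\<close>

lemma flow_Lip:
  fixes G :: "('g, 'm) monoid_scheme" (structure)
  assumes tg: "topological_group G T" and sn: "group_seminorm G T \<sigma>"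
  shows "group_flow G T (Lip_topology G \<sigma>) (shift G \<sigma>)"
proof (rule group_flowI[OF tg])
  interpret group G using tg by (simp add: topological_group_def)
  have top: "topspace T = carrier G" using tg by (simp add: topological_group_def)
  have "(\<lambda>h\<in>carrier G. 0) \<in> Lip G \<sigma>"
    using sn by (auto simp: Lip_def group_seminorm_def)
  then show "topspace (Lip_topology G \<sigma>) \<noteq> {}" by auto
  show "compact_space (Lip_topology G \<sigma>)" using is_group by (rule compact_Lip)
  show "Hausdorff_space (Lip_topology G \<sigma>)"
    unfolding Lip_topology_def
    by (intro Hausdorff_space_subtopology) (simp add: Hausdorff_space_product_topology)
  show "shift G \<sigma> g \<in> extensional (topspace (Lip_topology G \<sigma>))" for g
    by (simp add: shift_def)
  show cl: "shift G \<sigma> g f \<in> topspace (Lip_topology G \<sigma>)"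
    if "g \<in> carrier G" "f \<in> topspace (Lip_topology G \<sigma>)" for g f
    using that by (auto simp: shift_def Lip_def PiE_iff m_assoc)
  show "shift G \<sigma> \<one> f = f" if "f \<in> topspace (Lip_topology G \<sigma>)" for f
    by (rule extensionalityI[of _ "carrier G"]) (use that in \<open>auto simp: shift_def Lip_def PiE_iff\<close>)
  show "shift G \<sigma> (g \<otimes> h) f = shift G \<sigma> g (shift G \<sigma> h f)"
    if "g \<in> carrier G" "h \<in> carrier G" "f \<in> topspace (Lip_topology G \<sigma>)" for g h f
    by (rule extensionalityI[of _ "carrier G"])
       (use that cl[of h f] in \<open>auto simp: shift_def Lip_def PiE_iff m_assoc\<close>)
  let ?X = "prod_topology T (Lip_topology G \<sigma>)"
  have "continuous_map ?X euclideanreal (\<lambda>(g, f). f (h \<otimes> g))" if h: "h \<in> carrier G" for h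
    unfolding continuous_map_def
  proof (intro conjI allI impI)
    fix U :: "real set" assume U: "openin euclideanreal U"
    show "openin ?X {p \<in> topspace ?X. (case p of (g, f) \<Rightarrow> f (h \<otimes> g)) \<in> U}"
      unfolding openin_prod_topology_alt
    proof (intro allI impI)
      fix g\<^sub>0 f\<^sub>0 assume "(g\<^sub>0, f\<^sub>0) \<in> {p \<in> topspace ?X. (case p of (g, f) \<Rightarrow> f (h \<otimes> g)) \<in> U}"
      then have g0: "g\<^sub>0 \<in> carrier G" and f0: "f\<^sub>0 \<in> Lip G \<sigma>" and "f\<^sub>0 (h \<otimes> g\<^sub>0) \<in> U"
        using top by auto
      then obtain e where e: "e > 0" "ball (f\<^sub>0 (h \<otimes> g\<^sub>0)) e \<subseteq> U"
        using U open_contains_ball by (metis open_openin)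
      obtain V where V: "openin T V" "\<one> \<in> V" "\<And>v. v \<in> V \<Longrightarrow> \<sigma> v < e / 2"
        using sn e(1) unfolding group_seminorm_def by (meson half_gt_zero)
      let ?c = "\<lambda>g. h \<otimes> g \<otimes> (inv g\<^sub>0 \<otimes> inv h)"
      have "continuous_map T T ?c"
        using continuous_map_compose[OF topological_group_translations(1)[OF tg h]
            topological_group_translations(2)[OF tg, of "inv g\<^sub>0 \<otimes> inv h"]] g0 h
        by (simp add: o_def)
      then have A: "openin T {g \<in> topspace T. ?c g \<in> V}"
        using V(1) by (rule openin_continuous_map_preimage)
      have "continuous_map (Lip_topology G \<sigma>) euclideanreal (\<lambda>f. f (h \<otimes> g\<^sub>0))"
        using g0 h by (intro continuous_map_eval_Lip) auto
      then have B: "openin (Lip_topology G \<sigma>) {f \<in> topspace (Lip_topology G \<sigma>). f (h \<otimes> g\<^sub>0) \<in> ball (f\<^sub>0 (h \<otimes> g\<^sub>0)) (e / 2)}"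
        by (rule openin_continuous_map_preimage) simp
      have "f (h \<otimes> g) \<in> U"
        if g: "g \<in> carrier G" "?c g \<in> V" and f: "f \<in> Lip G \<sigma>" "f (h \<otimes> g\<^sub>0) \<in> ball (f\<^sub>0 (h \<otimes> g\<^sub>0)) (e / 2)" for g f
      proof -
        have "?c g \<otimes> (h \<otimes> g\<^sub>0) = h \<otimes> g \<otimes> ((inv g\<^sub>0 \<otimes> inv h) \<otimes> (h \<otimes> g\<^sub>0))"
          using g0 h g(1) by (simp add: m_assoc)
        also have "(inv g\<^sub>0 \<otimes> inv h) \<otimes> (h \<otimes> g\<^sub>0) = \<one>"
          using g0 h by (simp flip: inv_mult_group)
        finally have eq: "?c g \<otimes> (h \<otimes> g\<^sub>0) = h \<otimes> g" using g(1) h by simp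
        have "?c g \<in> carrier G" "h \<otimes> g\<^sub>0 \<in> carrier G" using g(1) g0 h by auto
        then have "\<bar>f (?c g \<otimes> (h \<otimes> g\<^sub>0)) - f (h \<otimes> g\<^sub>0)\<bar> \<le> \<sigma> (?c g)"
          using f(1) unfolding Lip_def by blast
        then have "\<bar>f (h \<otimes> g) - f (h \<otimes> g\<^sub>0)\<bar> < e / 2"
          using V(3)[OF g(2)] unfolding eq by linarith
        moreover have "\<bar>f\<^sub>0 (h \<otimes> g\<^sub>0) - f (h \<otimes> g\<^sub>0)\<bar> < e / 2"
          using f(2) by (simp add: dist_real_def)
        ultimately have "\<bar>f\<^sub>0 (h \<otimes> g\<^sub>0) - f (h \<otimes> g)\<bar> < e" by linarith
        then have "f (h \<otimes> g) \<in> ball (f\<^sub>0 (h \<otimes> g\<^sub>0)) e" by (simp add: dist_real_def)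
        then show ?thesis using e(2) by blast
      qed
      moreover have "g\<^sub>0 \<in> {g \<in> topspace T. ?c g \<in> V}"
      proof -
        have "?c g\<^sub>0 = \<one>" using g0 h by (simp flip: inv_mult_group)
        then show ?thesis using g0 V(2) top by simp
      qed
      ultimately show "\<exists>A B. openin T A \<and> openin (Lip_topology G \<sigma>) B \<and> g\<^sub>0 \<in> A \<and> f\<^sub>0 \<in> B \<and>
          A \<times> B \<subseteq> {p \<in> topspace ?X. (case p of (g, f) \<Rightarrow> f (h \<otimes> g)) \<in> U}"
        using f0 e(1) top
        by (intro exI[of _ "{g \<in> topspace T. ?c g \<in> V}"] conjI A
            exI[of _ "{f \<in> topspace (Lip_topology G \<sigma>). f (h \<otimes> g\<^sub>0) \<in> ball (f\<^sub>0 (h \<otimes> g\<^sub>0)) (e / 2)}"] B)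
           auto
    qed
  qed auto
  then have "continuous_map ?X euclideanreal (\<lambda>p. (case p of (g, f) \<Rightarrow> shift G \<sigma> g f) h)"
    if "h \<in> carrier G" for h
    by (rule continuous_map_eq) (use that in \<open>auto simp: shift_def\<close>)
  then show "continuous_map ?X (Lip_topology G \<sigma>) (\<lambda>(g, f). shift G \<sigma> g f)"
    unfolding continuous_map_into_Lip using cl top by auto
qed

lemma group_flow_pullback:
  assumes "group_flow K S X \<phi>" and tg: "topological_group G T"
    and hom: "\<pi> \<in> hom G K" and cont: "continuous_map T S \<pi>"
  shows "group_flow G T X (\<lambda>g. \<phi> (\<pi> g))"
proof -
  interpret K: group_flow K S X \<phi> by fact
  interpret G: group G using tg by (simp add: topological_group_def)
  interpret group_hom G K \<pi> using hom K.is_group G.is_group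
    by (simp add: group_hom_def group_hom_axioms_def)
  show ?thesis
  proof (rule group_flowI[OF tg K.nonempty K.compact K.Hausdorff])
    have "continuous_map (prod_topology T X) (prod_topology S X) (\<lambda>(g, x). (\<pi> g, x))"
      using cont by (simp add: continuous_map_prod_top id_def[symmetric])
    from continuous_map_compose[OF this K.cont]
    show "continuous_map (prod_topology T X) X (\<lambda>(g, x). \<phi> (\<pi> g) x)"
      by (simp add: o_def case_prod_unfold)
  qed (auto simp: K.act_ext K.act_mult)
qed

section \<open>Uniform recurrence in CAP groups\<close>

text \<open>Evaluation principle: applied to the Ellis semigroup with \<open>e\<close> the identity map and \<open>M\<close> a left
  ideal, and with \<open>\<theta>\<close> the evaluation at an almost periodic point, it says that \<open>M\<close> moves this point
  through its whole orbit closure.\<close>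

lemma subflow_image_orbit_closure:
  assumes "group_flow G T X \<phi>" "group_flow G T Z \<psi>"
    and \<theta>: "continuous_map X Z \<theta>"
    and eq: "\<And>g y. g \<in> carrier G \<Longrightarrow> y \<in> topspace X \<Longrightarrow> \<theta> (\<phi> g y) = \<psi> g (\<theta> y)"
    and e: "e \<in> topspace X" and M: "subflow G X \<phi> M" "M \<subseteq> X closure_of (orbit G \<phi> e)"
    and AP: "\<theta> e \<in> AP G T Z \<psi>"
  shows "\<theta> ` M = Z closure_of (orbit G \<psi> (\<theta> e))"
proof -
  interpret X: group_flow G T X \<phi> by fact
  interpret Z: group_flow G T Z \<psi> by fact
  let ?C = "Z closure_of (orbit G \<psi> (\<theta> e))"
  have "\<theta> e \<in> topspace Z" using AP Z.AP_subset by blast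
  then have C: "subflow G Z \<psi> ?C" "\<theta> e \<in> ?C"
    by (rule Z.orbit_closure_subflow, rule Z.in_orbit_closure)
  have im: "subflow G Z \<psi> (\<theta> ` M)"
    by (rule subflow_image[OF assms(1,2) \<theta> _ M(1)]) (use eq X.subflow_subset[OF M(1)] in blast)
  have "\<theta> y \<in> ?C" if "y \<in> M" for y
  proof -
    have "y \<in> {y \<in> topspace X. \<theta> y \<in> ?C}"
    proof (rule X.orbit_closure_induct[OF _ e])
      show "y \<in> X closure_of (orbit G \<phi> e)" using that M(2) by blast
      show "closedin X {y \<in> topspace X. \<theta> y \<in> ?C}"
        using \<theta> closedin_closure_of by (rule closedin_continuous_map_preimage)
      show "\<phi> g e \<in> {y \<in> topspace X. \<theta> y \<in> ?C}" if "g \<in> carrier G" for g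
        using subflow_closed[OF C(1) that C(2)] that e by (simp add: eq)
    qed
    then show ?thesis by simp
  qed
  then have "\<theta> ` M \<subseteq> ?C" by blast
  then show ?thesis
    using Z.AP_orbit_closure[OF AP] im unfolding Z.minimal_subflow_def by blast
qed

text \<open>In a minimal closed subsemigroup \<open>A\<close> every \<open>u\<close> satisfies \<open>A u = A\<close>, and then the closed
  subsemigroup of all \<open>a\<close> with \<open>a u = u\<close> is non-empty, so it is \<open>A\<close> and contains \<open>u\<close>.\<close>

lemma Ellis_Numakura:
  fixes op :: "'a \<Rightarrow> 'a \<Rightarrow> 'a" (infixl "\<star>" 70)
  assumes X: "compact_space X" "Hausdorff_space X"
    and S: "closedin X S" "S \<noteq> {}"
    and cl: "\<And>a b. a \<in> S \<Longrightarrow> b \<in> S \<Longrightarrow> a \<star> b \<in> S"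
    and assoc: "\<And>a b c. a \<in> S \<Longrightarrow> b \<in> S \<Longrightarrow> c \<in> S \<Longrightarrow> a \<star> b \<star> c = a \<star> (b \<star> c)"
    and cont: "\<And>s. s \<in> S \<Longrightarrow> continuous_map X X (\<lambda>q. q \<star> s)"
  obtains u where "u \<in> S" "u \<star> u = u"
proof -
  define \<A> where "\<A> = {A. closedin X A \<and> A \<noteq> {} \<and> A \<subseteq> S \<and> (\<forall>a\<in>A. \<forall>b\<in>A. a \<star> b \<in> A)}"
  have "S \<in> \<A>" using S cl by (simp add: \<A>_def)
  moreover have "\<forall>A\<in>\<A>. closedin X A \<and> A \<noteq> {}" by (simp add: \<A>_def)
  moreover have "\<forall>\<C>. \<C> \<noteq> {} \<longrightarrow> \<C> \<subseteq> \<A> \<longrightarrow> \<Inter>\<C> \<noteq> {} \<longrightarrow> \<Inter>\<C> \<in> \<A>"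
  proof (intro allI impI)
    fix \<C> assume \<C>: "\<C> \<noteq> {}" "\<C> \<subseteq> \<A>" "\<Inter>\<C> \<noteq> {}"
    then have "closedin X (\<Inter>\<C>)" by (intro closedin_Inter) (auto simp: \<A>_def)
    moreover have "\<Inter>\<C> \<subseteq> S" using \<C>(1,2) by (auto simp: \<A>_def)
    moreover have "a \<star> b \<in> \<Inter>\<C>" if "a \<in> \<Inter>\<C>" "b \<in> \<Inter>\<C>" for a b
      using \<C>(2) that unfolding \<A>_def by (intro InterI) (simp add: subset_iff)
    ultimately show "\<Inter>\<C> \<in> \<A>" using \<C>(3) by (simp add: \<A>_def)
  qed
  ultimately have "\<exists>A\<in>\<A>. A \<subseteq> S \<and> (\<forall>Y\<in>\<A>. Y \<subseteq> A \<longrightarrow> Y = A)"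
    by (rule minimal_closed_set[OF X(1)])
  then obtain A where A: "closedin X A" "A \<noteq> {}" "A \<subseteq> S" "\<And>a b. a \<in> A \<Longrightarrow> b \<in> A \<Longrightarrow> a \<star> b \<in> A"
    and min: "\<And>Y. Y \<in> \<A> \<Longrightarrow> Y \<subseteq> A \<Longrightarrow> Y = A"
    by (auto simp: \<A>_def)
  obtain u where u: "u \<in> A" using A(2) by blast
  then have uS: "u \<in> S" using A(3) by blast
  have "(\<lambda>q. q \<star> u) ` A = A"
  proof (rule min)
    have "closedin X ((\<lambda>q. q \<star> u) ` A)"
      using T1_Spaces.continuous_imp_closed_map[OF cont[OF uS] X] A(1) by (simp add: closed_map_def)
    moreover have "a \<star> u \<star> (b \<star> u) \<in> (\<lambda>q. q \<star> u) ` A" if ab: "a \<in> A" "b \<in> A" for a b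
    proof -
      have "a \<star> u \<in> A" "a \<star> u \<star> b \<in> A" using ab u A(4) by blast+
      moreover have "a \<star> u \<star> (b \<star> u) = a \<star> u \<star> b \<star> u"
        using assoc[of "a \<star> u" b u] calculation ab u A(3) by (simp add: subset_iff)
      ultimately show ?thesis by blast
    qed
    moreover show sub: "(\<lambda>q. q \<star> u) ` A \<subseteq> A" using A(4) u by blast
    ultimately show "(\<lambda>q. q \<star> u) ` A \<in> \<A>"
      using A(2,3) by (auto simp: \<A>_def)
  qed
  then have ex: "\<exists>a\<in>A. a \<star> u = u" using u by (metis imageE)
  have "{a \<in> A. a \<star> u = u} = A"
  proof (rule min)
    have "closedin X {a \<in> topspace X. a \<star> u \<in> {u}}"
      using cont[OF uS] closedin_Hausdorff_singleton[OF X(2)] closedin_subset[OF A(1)] u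
      by (intro closedin_continuous_map_preimage) auto
    then have "closedin X (A \<inter> {a \<in> topspace X. a \<star> u \<in> {u}})" using A(1) by (rule closedin_Int[rotated])
    moreover have "A \<inter> {a \<in> topspace X. a \<star> u \<in> {u}} = {a \<in> A. a \<star> u = u}"
      using closedin_subset[OF A(1)] by auto
    moreover have "a \<star> b \<star> u = u" if "a \<in> A" "b \<in> A" "a \<star> u = u" "b \<star> u = u" for a b
      using assoc[of a b u] that uS A(3) by (simp add: subset_iff)
    ultimately show "{a \<in> A. a \<star> u = u} \<in> \<A>"
      using ex A by (auto simp: \<A>_def)
  qed blast
  then have "u \<star> u = u" using u by blast
  then show ?thesis using uS that by blast
qed

text \<open>The point \<open>0\<close> is inserted so that the supremum is meaningful for empty \<open>D\<close>; for the
  non-negative functions below it changes nothing else.\<close>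

lemma tendsto_Sup_finite_subsets:
  fixes a :: "'a \<Rightarrow> real"
  assumes bdd: "\<And>f. f \<in> A \<Longrightarrow> a f \<le> B"
  shows "((\<lambda>D. Sup (insert 0 (a ` D))) \<longlongrightarrow> Sup (insert 0 (a ` A))) (finite_subsets_at_top A)"
proof -
  have "bdd_above (a ` A)" using bdd by (rule bdd_aboveI2)
  then have bA: "bdd_above (insert 0 (a ` A))" by simp
  show ?thesis
  proof (rule order_tendstoI)
    fix c assume "c < Sup (insert 0 (a ` A))"
    then obtain r where r: "r \<in> insert 0 (a ` A)" "c < r" using less_cSup_iff[OF _ bA] by auto
    have "\<exists>D0. finite D0 \<and> D0 \<subseteq> A \<and> r \<in> insert 0 (a ` D0)"
    proof (cases "r = 0")
      case False
      then obtain f where "f \<in> A" "r = a f" using r by auto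
      then show ?thesis by (intro exI[of _ "{f}"]) auto
    qed auto
    then obtain D0 where D0: "finite D0" "D0 \<subseteq> A" "r \<in> insert 0 (a ` D0)" by blast
    show "\<forall>\<^sub>F D in finite_subsets_at_top A. c < Sup (insert 0 (a ` D))"
    proof (rule eventually_finite_subsets_at_top[THEN iffD2], intro exI conjI allI impI)
      fix D assume D: "finite D \<and> D0 \<subseteq> D \<and> D \<subseteq> A"
      have "bdd_above (insert 0 (a ` D))" using D by simp
      then have "r \<le> Sup (insert 0 (a ` D))" using D0(3) D by (intro cSup_upper) auto
      then show "c < Sup (insert 0 (a ` D))" using r(2) by simp
    qed (use D0 in auto)
  next
    fix c assume c: "Sup (insert 0 (a ` A)) < c"
    show "\<forall>\<^sub>F D in finite_subsets_at_top A. Sup (insert 0 (a ` D)) < c"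
    proof (rule eventually_finite_subsets_at_top[THEN iffD2], intro exI conjI allI impI)
      fix D assume D: "finite D \<and> {} \<subseteq> D \<and> D \<subseteq> A"
      then have "Sup (insert 0 (a ` D)) \<le> Sup (insert 0 (a ` A))"
        using bA by (intro cSup_subset_mono) auto
      then show "Sup (insert 0 (a ` D)) < c" using c by simp
    qed auto
  qed
qed

lemma continuous_map_Sup_finite:
  fixes a :: "'f \<Rightarrow> 'y \<Rightarrow> real"
  assumes "finite D" "\<And>f. f \<in> D \<Longrightarrow> continuous_map Y euclideanreal (a f)"
  shows "continuous_map Y euclideanreal (\<lambda>y. Sup (insert 0 ((\<lambda>f. a f y) ` D)))"
  using assms
proof (induction D)
  case (insert d D)
  have "Sup (insert 0 ((\<lambda>f. a f y) ` insert d D)) = max (a d y) (Sup (insert 0 ((\<lambda>f. a f y) ` D)))" for y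
  proof -
    have "Sup (insert 0 ((\<lambda>f. a f y) ` insert d D)) = Sup (insert (a d y) (insert 0 ((\<lambda>f. a f y) ` D)))"
      by (simp add: insert_commute)
    also have "\<dots> = max (a d y) (Sup (insert 0 ((\<lambda>f. a f y) ` D)))"
      using insert.hyps(1) by (subst cSup_insert) (auto simp: sup_max)
    finally show ?thesis .
  qed
  then show ?case using insert by (simp add: continuous_map_real_max)
qed simp

lemma abs_diff_Sup_Lip:
  assumes "group G" and sn: "group_seminorm G T \<sigma>"
    and y: "\<And>f. f \<in> D \<Longrightarrow> y f \<in> Lip G \<sigma>" and c: "\<And>f. f \<in> D \<Longrightarrow> c f \<in> {0..1::real}"
  shows "(\<lambda>h\<in>carrier G. Sup (insert 0 ((\<lambda>f. \<bar>y f h - c f\<bar>) ` D))) \<in> Lip G \<sigma>" (is "?p \<in> _")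
proof -
  interpret group G by fact
  let ?S = "\<lambda>h. Sup (insert 0 ((\<lambda>f. \<bar>y f h - c f\<bar>) ` D))"
  have le1: "\<bar>y f h - c f\<bar> \<le> 1" if "f \<in> D" "h \<in> carrier G" for f h
    using Lip_bounds[OF y] c that by (fastforce simp: abs_le_iff)
  then have bdd: "bdd_above (insert 0 ((\<lambda>f. \<bar>y f h - c f\<bar>) ` D))" if "h \<in> carrier G" for h
    using bdd_aboveI2[of D "\<lambda>f. \<bar>y f h - c f\<bar>" 1] that by simp
  have S1: "?S h \<le> 1" if "h \<in> carrier G" for h
    using le1 that by (intro cSup_least) auto
  have S0: "0 \<le> ?S h" if "h \<in> carrier G" for h
    using bdd that by (intro cSup_upper) auto
  have step: "?S (g \<otimes>\<^bsub>G\<^esub> h) \<le> ?S h + \<sigma> g" if g: "g \<in> carrier G" and h: "h \<in> carrier G" for g h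
  proof (rule cSup_least)
    fix r assume "r \<in> insert 0 ((\<lambda>f. \<bar>y f (g \<otimes>\<^bsub>G\<^esub> h) - c f\<bar>) ` D)"
    then consider "r = 0" | f where "f \<in> D" "r = \<bar>y f (g \<otimes>\<^bsub>G\<^esub> h) - c f\<bar>" by auto
    then show "r \<le> ?S h + \<sigma> g"
    proof cases
      case 1
      then show ?thesis using S0[OF h] sn g by (simp add: group_seminorm_def)
    next
      case 2
      then have "\<bar>y f (g \<otimes>\<^bsub>G\<^esub> h) - y f h\<bar> \<le> \<sigma> g" using y g h by (auto simp: Lip_def)
      moreover have "\<bar>y f h - c f\<bar> \<le> ?S h" using bdd[OF h] 2 by (intro cSup_upper) auto
      ultimately show ?thesis using 2 by linarith
    qed
  qed auto
  have "\<bar>?S (g \<otimes>\<^bsub>G\<^esub> h) - ?S h\<bar> \<le> \<sigma> g" if g: "g \<in> carrier G" and h: "h \<in> carrier G" for g h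
  proof -
    have "inv\<^bsub>G\<^esub> g \<otimes>\<^bsub>G\<^esub> (g \<otimes>\<^bsub>G\<^esub> h) = h" using g h by (simp flip: m_assoc)
    then have "?S h \<le> ?S (g \<otimes>\<^bsub>G\<^esub> h) + \<sigma> (inv\<^bsub>G\<^esub> g)"
      using step[of "inv\<^bsub>G\<^esub> g" "g \<otimes>\<^bsub>G\<^esub> h"] g h by simp
    moreover have "\<sigma> (inv\<^bsub>G\<^esub> g) = \<sigma> g" using sn g by (simp add: group_seminorm_def)
    ultimately show ?thesis using step[OF g h] by linarith
  qed
  then show ?thesis using S0 S1 by (simp add: Lip_def)
qed

text \<open>The key step.  In the proof, \<open>L\<close> is the set of Lipschitz functions, \<open>E\<close> the flow of all self-maps
  of \<open>L\<close>, and \<open>M\<close> a minimal left ideal of the Ellis semigroup, which is the orbit closure of the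
  identity map \<open>e\<close> in \<open>E\<close>.  The claim \<open>nbhd\<close> says that each point of \<open>M\<close> has a neighbourhood
  on which all coordinates \<open>f\<close> oscillate little simultaneously; the return times of \<open>M\<close> to finitely many
  such neighbourhoods form the set \<open>F\<close>.\<close>

theorem CAP_uniformly_recurrent:
  fixes G :: "('g, 'm) monoid_scheme" (structure)
  assumes tg: "topological_group G T" and cap: "CAP G T" and sn: "group_seminorm G T \<sigma>"
  obtains F where "finite F" "F \<subseteq> carrier G"
    "\<And>f h. f \<in> AP G T (Lip_topology G \<sigma>) (shift G \<sigma>) \<Longrightarrow> f \<one> = 0 \<Longrightarrow> h \<in> carrier G \<Longrightarrow>
       \<exists>k\<in>F. f (k \<otimes> h) < 1"
proof -
  define L where "L = Lip G \<sigma>"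
  define X where "X = Lip_topology G \<sigma>"
  define \<tau> where "\<tau> = shift G \<sigma>"
  interpret L: group_flow G T X \<tau> unfolding X_def \<tau>_def using tg sn by (rule flow_Lip)
  have topX [simp]: "topspace X = L" by (simp add: X_def L_def)
  have \<tau>: "\<tau> g f h = f (h \<otimes> g)" if "f \<in> L" "h \<in> carrier G" for f g h
    using that by (simp add: \<tau>_def shift_def L_def)
  have X_eval: "continuous_map X euclideanreal (\<lambda>f. f h)" if "h \<in> carrier G" for h
    unfolding X_def using that by (rule continuous_map_eval_Lip)
  define E where "E = product_topology (\<lambda>_. X) L"
  define \<epsilon> where "\<epsilon> = (\<lambda>g. \<lambda>q\<in>L \<rightarrow>\<^sub>E L. \<lambda>f\<in>L. \<tau> g (q f))"
  interpret E: group_flow G T E \<epsilon>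
    using group_flow_power[OF L.group_flow_axioms, of L] by (simp add: E_def \<epsilon>_def)
  have topE [simp]: "topspace E = L \<rightarrow>\<^sub>E L" by (simp add: E_def)
  have \<epsilon>: "\<epsilon> g q f = \<tau> g (q f)" if "q \<in> L \<rightarrow>\<^sub>E L" "f \<in> L" for g q f
    using that by (simp add: \<epsilon>_def)
  have app: "q f \<in> L" if "q \<in> L \<rightarrow>\<^sub>E L" "f \<in> L" for q f using that by (rule PiE_mem)
  have ev: "continuous_map E X (\<lambda>q. q f)" if "f \<in> L" for f
    unfolding E_def using that by (rule continuous_map_product_projection)
  define e where "e = (\<lambda>f\<in>L. f)"
  have e: "e \<in> L \<rightarrow>\<^sub>E L" by (simp add: e_def)
  let ?c = "compose L"
  have comp_cl: "?c p q \<in> L \<rightarrow>\<^sub>E L" if "p \<in> L \<rightarrow>\<^sub>E L" "q \<in> L \<rightarrow>\<^sub>E L" for p q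
    using that by (auto simp: compose_def)
  have comp_eq: "?c p q f = p (q f)" if "f \<in> L" for p q f using that by (simp add: compose_eq)
  have assoc: "?c (?c p q) r = ?c p (?c q r)" if "r \<in> L \<rightarrow>\<^sub>E L" for p q r
    using that by (intro ext) (auto simp: compose_def)
  have cont_comp: "continuous_map E E (\<lambda>p. ?c p q)" if "q \<in> L \<rightarrow>\<^sub>E L" for q
  proof -
    have "continuous_map E X (\<lambda>p. ?c p q f)" if f: "f \<in> L" for f
      using ev[OF app[OF \<open>q \<in> L \<rightarrow>\<^sub>E L\<close> f]] by (simp add: comp_eq f)
    then show ?thesis
      unfolding E_def continuous_map_componentwise by (auto simp: compose_def)
  qed
  have eq_comp: "?c (\<epsilon> g p) q = \<epsilon> g (?c p q)" if "p \<in> L \<rightarrow>\<^sub>E L" "q \<in> L \<rightarrow>\<^sub>E L" for g p q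
    using that comp_cl[OF that] app[OF that(2)] by (intro ext) (simp add: compose_def \<epsilon>_def)
  have comp_e: "?c e q = q" if "q \<in> L \<rightarrow>\<^sub>E L" for q
    by (rule extensionalityI[of _ L]) (use that app in \<open>auto simp: comp_eq e_def compose_def PiE_def\<close>)
  obtain M where M: "E.minimal_subflow M" and Me: "M \<subseteq> E closure_of (orbit G \<epsilon> e)"
    using E.ex_minimal_subflow[OF E.orbit_closure_subflow[of e]] e by auto
  have sM: "subflow G E \<epsilon> M" using M by (simp add: E.minimal_subflow_def)
  have ME: "M \<subseteq> L \<rightarrow>\<^sub>E L" using E.subflow_subset[OF sM] by simp
  have MAP: "x \<in> AP G T E \<epsilon>" if "x \<in> M" for x using that M E.AP_minimal by blast
  have M_right: "(\<lambda>p. ?c p x) ` M = M" if x: "x \<in> M" for x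
  proof -
    have xE: "x \<in> L \<rightarrow>\<^sub>E L" using x ME by blast
    have "(\<lambda>p. ?c p x) ` M = E closure_of (orbit G \<epsilon> (?c e x))"
      using eq_comp xE e Me sM MAP[OF x]
      by (intro subflow_image_orbit_closure[OF E.group_flow_axioms E.group_flow_axioms cont_comp])
         (simp_all add: comp_e)
    then show ?thesis using E.minimal_subflow_orbit_closure[OF M x] by (simp add: comp_e xE)
  qed
  have M_comp: "?c p x \<in> M" if "p \<in> M" "x \<in> M" for p x using M_right[OF that(2)] that(1) by blast
  have M_solve: "\<exists>p\<in>M. ?c p x = y" if "x \<in> M" "y \<in> M" for x y
    using M_right[OF that(1)] that(2) by (metis imageE)

  \<comment> \<open>The bound 1/3 leaves room for a triangle inequality through \<open>x\<close> with total below 1.\<close>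
  have nbhd: "\<exists>N. openin E N \<and> x \<in> N \<and> (\<forall>y\<in>N \<inter> M. \<forall>f\<in>L. \<bar>y f \<one> - x f \<one>\<bar> \<le> 1 / 3)" if x: "x \<in> M" for x
  proof -
    have xE: "x \<in> L \<rightarrow>\<^sub>E L" using x ME by blast
    define p where "p D y = (\<lambda>h\<in>carrier G. Sup (insert 0 ((\<lambda>f. \<bar>y f h - x f \<one>\<bar>) ` D)))" for D and y :: "('g \<Rightarrow> real) \<Rightarrow> 'g \<Rightarrow> real"
    have c01: "x f \<one> \<in> {0..1}" if "f \<in> L" for f
      using Lip_bounds[of "x f" G \<sigma> \<one>] app[OF xE that] by (simp add: L_def)
    have pL: "p D y \<in> L" if "D \<subseteq> L" "y \<in> L \<rightarrow>\<^sub>E L" for D y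
      unfolding p_def L_def
      by (rule abs_diff_Sup_Lip[OF L.is_group sn])
         (use that app c01 in \<open>auto simp: L_def subset_iff\<close>)
    let ?P = "prod_topology E X"
    let ?\<rho> = "\<lambda>g. \<lambda>(q, f)\<in>topspace E \<times> topspace X. (\<epsilon> g q, \<tau> g f)"
    interpret P: group_flow G T ?P ?\<rho>
      by (rule group_flow_prod[OF E.group_flow_axioms L.group_flow_axioms])
    \<comment> \<open>For finite \<open>D\<close> the map \<open>y \<mapsto> p D y\<close> is continuous and equivariant, so the graph over \<open>M\<close> is minimal.\<close>
    have finite_AP: "(x, p D x) \<in> AP G T ?P ?\<rho>" if D: "finite D" "D \<subseteq> L" for D
    proof -
      have "continuous_map E euclideanreal (\<lambda>y. p D y h)" if h: "h \<in> carrier G" for h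
      proof -
        have "continuous_map E euclideanreal (\<lambda>y. \<bar>y f h - x f \<one>\<bar>)" if f: "f \<in> D" for f
          using continuous_map_compose[OF ev[of f] X_eval[OF h]] f D(2)
          by (intro continuous_map_real_abs continuous_map_diff) (auto simp: o_def)
        then show ?thesis unfolding p_def
          using h continuous_map_Sup_finite[OF D(1), where a = "\<lambda>f y. \<bar>y f h - x f \<one>\<bar>"] by simp
      qed
      then have "continuous_map E X (p D)"
        unfolding X_def continuous_map_into_Lip using pL[OF D(2)] by (auto simp: L_def)
      then have "continuous_map E ?P (\<lambda>y. (y, p D y))"
        by (simp add: continuous_map_pairedI)
      moreover have "(\<epsilon> g y, p D (\<epsilon> g y)) = ?\<rho> g (y, p D y)" if g: "g \<in> carrier G" and y: "y \<in> M" for g y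
      proof -
        have yE: "y \<in> L \<rightarrow>\<^sub>E L" using y ME by blast
        have "p D (\<epsilon> g y) = \<tau> g (p D y)"
        proof (rule extensionalityI[of _ "carrier G"])
          show "\<tau> g (p D y) \<in> extensional (carrier G)"
            using L.act_closed[OF g, of "p D y"] pL[OF D(2) yE] by (simp add: L_def Lip_def PiE_def)
          fix h assume h: "h \<in> carrier G"
          have "\<epsilon> g y f h = y f (h \<otimes> g)" if "f \<in> D" for f
            using that D(2) h app[OF yE] by (simp add: \<epsilon> yE \<tau> subset_iff)
          then have "(\<lambda>f. \<bar>\<epsilon> g y f h - x f \<one>\<bar>) ` D = (\<lambda>f. \<bar>y f (h \<otimes> g) - x f \<one>\<bar>) ` D"
            by (intro image_cong) auto
          then show "p D (\<epsilon> g y) h = \<tau> g (p D y) h"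
            using h g \<tau>[OF pL[OF D(2) yE] h] by (simp add: p_def)
        qed (simp add: p_def)
        then show ?thesis using yE pL[OF D(2) yE] by simp
      qed
      ultimately have "P.minimal_subflow ((\<lambda>y. (y, p D y)) ` M)"
        by (rule minimal_subflow_image[OF E.group_flow_axioms P.group_flow_axioms _ _ M])
      then show ?thesis unfolding P.AP_minimal using x by blast
    qed
    define r where "r = p L x"
    have rL: "r \<in> L" unfolding r_def using pL xE by blast
    have r_bound: "\<bar>x f h - x f \<one>\<bar> \<le> r h" if f: "f \<in> L" and h: "h \<in> carrier G" for f h
    proof -
      have "\<bar>x f h - x f \<one>\<bar> \<le> 1" if "f \<in> L" for f
        using Lip_bounds[of "x f" G \<sigma> h] app[OF xE that] c01[OF that] h by (simp add: L_def abs_le_iff)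
      then have "bdd_above ((\<lambda>f. \<bar>x f h - x f \<one>\<bar>) ` L)" by (rule bdd_aboveI2)
      then show ?thesis unfolding r_def p_def using f h by (auto intro!: cSup_upper)
    qed
    \<comment> \<open>This is where CAP enters: the supremum over all of \<open>L\<close> is a limit of those over finite sets.\<close>
    have AP: "(x, r) \<in> AP G T ?P ?\<rho>"
    proof -
      have "CAP_on TYPE((('g \<Rightarrow> real) \<Rightarrow> 'g \<Rightarrow> real) \<times> ('g \<Rightarrow> real)) G T"
        using tg cap by (rule CAP_imp_CAP_on)
      then have clP: "closedin ?P (AP G T ?P ?\<rho>)" using P.fl unfolding CAP_on_def by blast
      have "continuous_map X ?P (\<lambda>q. (x, q))"
        using xE by (intro continuous_map_pairedI) auto
      then have clC: "closedin X {q \<in> topspace X. (x, q) \<in> AP G T ?P ?\<rho>}"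
        using clP by (rule closedin_continuous_map_preimage)
      have "limitin X (\<lambda>D. p D x) r (finite_subsets_at_top L)"
        unfolding X_def Lip_topology_def limitin_subtopology limitin_componentwise
      proof (intro conjI ballI)
        show "r \<in> Lip G \<sigma>" "r \<in> extensional (carrier G)" using rL by (auto simp: L_def Lip_def PiE_def)
        show ev: "\<forall>\<^sub>F D in finite_subsets_at_top L. p D x \<in> Lip G \<sigma>"
          using pL xE by (intro eventually_finite_subsets_at_top_weakI) (auto simp: L_def)
        show "\<forall>\<^sub>F D in finite_subsets_at_top L. p D x \<in> topspace (product_topology (\<lambda>_. euclideanreal) (carrier G))"
          by (simp add: p_def)
        fix h assume h: "h \<in> carrier G"
        have "\<bar>x f h - x f \<one>\<bar> \<le> r h" if "f \<in> L" for f using r_bound that h by blast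
        from tendsto_Sup_finite_subsets[of L, OF this]
        show "limitin euclideanreal (\<lambda>D. p D x h) (r h) (finite_subsets_at_top L)"
          using h by (simp add: p_def r_def)
      qed
      then have "r \<in> {q \<in> topspace X. (x, q) \<in> AP G T ?P ?\<rho>}"
      proof (rule limitin_closedin[OF _ clC])
        show "\<forall>\<^sub>F D in finite_subsets_at_top L. p D x \<in> {q \<in> topspace X. (x, q) \<in> AP G T ?P ?\<rho>}"
          using finite_AP pL xE by (intro eventually_finite_subsets_at_top_weakI) auto
      qed simp
      then show ?thesis by simp
    qed
    let ?\<theta> = "\<lambda>q. (?c q x, q r)"
    have c\<theta>: "continuous_map E ?P ?\<theta>"
      using cont_comp[OF xE] ev[OF rL] by (rule continuous_map_pairedI)
    have "?\<theta> ` M = ?P closure_of (orbit G ?\<rho> (?\<theta> e))"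
    proof (rule subflow_image_orbit_closure[OF E.group_flow_axioms P.group_flow_axioms c\<theta> _ _ sM Me])
      show "?\<theta> (\<epsilon> g y) = ?\<rho> g (?\<theta> y)" if "g \<in> carrier G" "y \<in> topspace E" for g y
        using that eq_comp[of y x] comp_cl[of y x] xE \<epsilon>[of y r g] rL app[of y r] by simp
      show "e \<in> topspace E" using e by simp
      show "?\<theta> e \<in> AP G T ?P ?\<rho>" using AP rL xE comp_e by (simp add: e_def)
    qed
    moreover have \<theta>e: "?\<theta> e = (x, r)" using comp_e[OF xE] rL by (simp add: e_def)
    ultimately have "(x, r) \<in> ?\<theta> ` M"
      using P.in_orbit_closure[of "(x, r)"] xE rL by simp
    let ?S = "{m \<in> M. ?c m x = x \<and> m r = r}"
    have S: "closedin E ?S"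
    proof -
      have "closedin ?P {(x, r)}" using P.Hausdorff xE rL by (intro closedin_Hausdorff_singleton) simp_all
      then have "closedin E (M \<inter> {q \<in> topspace E. ?\<theta> q \<in> {(x, r)}})"
        using c\<theta> sM by (intro closedin_Int closedin_continuous_map_preimage) (auto simp: subflow_def)
      moreover have "M \<inter> {q \<in> topspace E. ?\<theta> q \<in> {(x, r)}} = ?S" using ME by auto
      ultimately show ?thesis by simp
    qed
    from \<open>(x, r) \<in> ?\<theta> ` M\<close> obtain m where m: "(x, r) = ?\<theta> m" "m \<in> M" by (rule imageE)
    then have "?c m x = x" "m r = r" by (metis prod.inject)+
    then have "m \<in> ?S" using m(2) by blast
    obtain u where u: "u \<in> ?S" "?c u u = u"
    proof (rule Ellis_Numakura[OF E.compact E.Hausdorff S, of ?c])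
      show "?S \<noteq> {}" using \<open>m \<in> ?S\<close> by blast
      show "?c a b \<in> ?S" if "a \<in> ?S" "b \<in> ?S" for a b
        using that M_comp[of a b] assoc[of x a b] xE rL by (simp add: comp_eq)
      show "?c (?c a b) d = ?c a (?c b d)" if "d \<in> ?S" for a b d
        using that ME by (intro assoc) blast
      show "continuous_map E E (\<lambda>q. ?c q s)" if "s \<in> ?S" for s
        using that ME by (intro cont_comp) blast
    qed
    \<comment> \<open>The product \<open>z = u y\<close> is a right inverse of \<open>x\<close> relative to \<open>u\<close>, as in the group \<open>u M\<close>.\<close>
    obtain y where y: "y \<in> M" "?c y x = u" using M_solve[of x u] x u(1) by blast
    define z where "z = ?c u y"
    have zM: "z \<in> M" using M_comp u(1) y(1) by (simp add: z_def)
    obtain w where w: "w \<in> M" "?c w z = u" using M_solve[of z u] zM u(1) by blast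
    have inE: "x \<in> L \<rightarrow>\<^sub>E L" "u \<in> L \<rightarrow>\<^sub>E L" "y \<in> L \<rightarrow>\<^sub>E L" "z \<in> L \<rightarrow>\<^sub>E L" "w \<in> L \<rightarrow>\<^sub>E L"
      using x u y zM w ME by auto
    have "?c z x = u" using assoc[of x u y] inE y u by (simp add: z_def)
    then have wu: "?c w u = x" using assoc[of x w z] inE w u by simp
    have uz: "?c u z = z" using assoc[of y u u] inE u by (simp add: z_def)
    have xz: "?c x z = u" using assoc[of z w u] inE wu uz w by simp
    have zr: "z r \<in> L" using app inE rL by blast
    have xzr: "x (z r) = r" using xz u(1) rL by (metis (mono_tags, lifting) comp_eq mem_Collect_eq)
    have cont_1: "continuous_map E euclideanreal (\<lambda>y. y f \<one>)" if "f \<in> L" for f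
      using continuous_map_compose[OF ev[OF that] X_eval[OF L.one_closed]] by (simp add: o_def)
    \<comment> \<open>On the orbit of \<open>x\<close> the continuous function \<open>y \<mapsto> y (z r) \<one>\<close> agrees with \<open>r\<close>, as \<open>x (z r) = r\<close>.\<close>
    define N where "N = {y \<in> topspace E. y (z r) \<one> \<in> {..<1/3}}"
    have "openin E N"
      unfolding N_def using cont_1[OF zr] by (rule openin_continuous_map_preimage) simp
    moreover have "x \<in> N"
    proof -
      have "r \<one> = Sup (insert 0 ((\<lambda>f. 0) ` L))" by (simp add: r_def p_def)
      also have "insert 0 ((\<lambda>f. 0::real) ` L) = {0}" by auto
      finally show ?thesis using xE xzr by (simp add: N_def)
    qed
    moreover have "\<bar>y f \<one> - x f \<one>\<bar> \<le> 1 / 3" if y: "y \<in> N \<inter> M" and f: "f \<in> L" for y f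
    proof -
      let ?d = "\<lambda>y. \<bar>y f \<one> - x f \<one>\<bar> - y (z r) \<one>"
      have "y \<in> {y \<in> topspace E. ?d y \<in> {..0}}"
      proof (rule E.orbit_closure_induct)
        show "y \<in> E closure_of (orbit G \<epsilon> x)" using y E.minimal_subflow_orbit_closure[OF M x] by simp
        show "x \<in> topspace E" using xE by simp
        have "continuous_map E euclideanreal ?d"
          using cont_1[OF f] cont_1[OF zr]
          by (intro continuous_map_diff continuous_map_real_abs) auto
        then show "closedin E {y \<in> topspace E. ?d y \<in> {..0}}"
          by (rule closedin_continuous_map_preimage) simp
        fix k assume k: "k \<in> carrier G"
        have "\<epsilon> k x f \<one> = x f k" "\<epsilon> k x (z r) \<one> = r k"
          using k app[OF xE] f zr rL by (simp_all add: \<epsilon> xE \<tau> xzr)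
        then show "\<epsilon> k x \<in> {y \<in> topspace E. ?d y \<in> {..0}}"
          using r_bound[OF f k] E.act_closed[OF k, of x] xE by simp
      qed
      then show ?thesis using y by (simp add: N_def)
    qed
    ultimately show ?thesis by blast
  qed
  then obtain N where N: "\<And>x. x \<in> M \<Longrightarrow> openin E (N x) \<and> x \<in> N x"
    and Nd: "\<And>x y f. x \<in> M \<Longrightarrow> y \<in> N x \<inter> M \<Longrightarrow> f \<in> L \<Longrightarrow> \<bar>y f \<one> - x f \<one>\<bar> \<le> 1 / 3"
    by metis
  have "compactin E M"
    using sM E.compact closedin_compact_space by (auto simp: subflow_def)
  moreover have "\<forall>U\<in>N ` M. openin E U" "M \<subseteq> \<Union>(N ` M)" using N by blast+
  ultimately obtain \<N> where \<N>: "finite \<N>" "\<N> \<subseteq> N ` M" "M \<subseteq> \<Union>\<N>"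
    unfolding compactin_def by meson
  obtain Y where Y: "Y \<subseteq> M" "finite Y" "\<N> = N ` Y" using finite_subset_image[OF \<N>(1,2)] by auto
  have "\<exists>F. finite F \<and> F \<subseteq> carrier G \<and> (\<forall>y\<in>M. \<exists>k\<in>F. \<epsilon> k y \<in> N x)" if x: "x \<in> Y" for x
  proof -
    have "openin E (N x)" "N x \<inter> M \<noteq> {}" using x Y(1) N by blast+
    then show ?thesis using E.minimal_subflow_syndetic[OF M] by metis
  qed
  then obtain F where F: "\<And>x. x \<in> Y \<Longrightarrow> finite (F x) \<and> F x \<subseteq> carrier G \<and> (\<forall>y\<in>M. \<exists>k\<in>F x. \<epsilon> k y \<in> N x)"
    by metis
  show thesis
  proof (rule that[of "\<Union>x\<in>Y. F x"])
    show "finite (\<Union>x\<in>Y. F x)" "(\<Union>x\<in>Y. F x) \<subseteq> carrier G" using Y(2) F by blast+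
    fix f h assume fAP: "f \<in> AP G T (Lip_topology G \<sigma>) (shift G \<sigma>)" and f1: "f \<one> = 0" and h: "h \<in> carrier G"
    have f: "f \<in> L" using fAP L.AP_subset by (auto simp: X_def \<tau>_def L_def)
    have "(\<lambda>q. q f) ` M = X closure_of (orbit G \<tau> (e f))"
    proof (rule subflow_image_orbit_closure[OF E.group_flow_axioms L.group_flow_axioms ev[OF f] _ _ sM Me])
      show "\<epsilon> g y f = \<tau> g (y f)" if "g \<in> carrier G" "y \<in> topspace E" for g y
        using that f by (simp add: \<epsilon>)
    qed (use e fAP f in \<open>simp_all add: X_def \<tau>_def e_def\<close>)
    then have "f \<in> (\<lambda>q. q f) ` M" using L.in_orbit_closure[of f] f by (simp add: e_def)
    then obtain m where m: "m \<in> M" "m f = f" by force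
    then obtain x where x: "x \<in> Y" "m \<in> N x" using \<N>(3) Y(3) by blast
    have hm: "\<epsilon> h m \<in> M" using subflow_closed[OF sM h m(1)] .
    then obtain k where k: "k \<in> F x" "\<epsilon> k (\<epsilon> h m) \<in> N x" using F[OF x(1)] by blast
    have kG: "k \<in> carrier G" using F[OF x(1)] k(1) by blast
    have mE: "m \<in> L \<rightarrow>\<^sub>E L" using m ME by blast
    have "\<epsilon> k (\<epsilon> h m) = \<epsilon> (k \<otimes> h) m" using E.act_mult[OF kG h] mE by simp
    moreover have "\<epsilon> (k \<otimes> h) m f \<one> = f (k \<otimes> h)" using kG h mE f m(2) by (simp add: \<epsilon> \<tau>)
    moreover have "\<epsilon> k (\<epsilon> h m) \<in> M" using subflow_closed[OF sM kG hm] .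
    ultimately have "\<bar>f (k \<otimes> h) - x f \<one>\<bar> \<le> 1 / 3"
      using Nd[of x "\<epsilon> k (\<epsilon> h m)" f] k(2) x(1) Y(1) f by auto
    moreover have "\<bar>f \<one> - x f \<one>\<bar> \<le> 1 / 3" using Nd[of x m f] m x Y(1) f by auto
    ultimately have "f (k \<otimes> h) < 1" using f1 by linarith
    then show "\<exists>k\<in>\<Union>x\<in>Y. F x. f (k \<otimes> h) < 1" using k(1) x(1) by blast
  qed
qed

section \<open>Recurrence in arbitrary flows\<close>

text \<open>The function is \<open>min 1 (inf \<sigma>(k inv b))\<close>, the infimum being over \<open>b \<in> B\<close>.\<close>

lemma truncated_distance_Lip:
  assumes "group K" and sn: "group_seminorm K S \<sigma>" and B: "B \<subseteq> carrier K" "B \<noteq> {}"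
  obtains f where "f \<in> Lip K \<sigma>" "\<And>b. b \<in> B \<Longrightarrow> f b = 0"
    "\<And>k. k \<in> carrier K \<Longrightarrow> f k < 1 \<Longrightarrow> \<exists>b\<in>B. \<sigma> (k \<otimes>\<^bsub>K\<^esub> inv\<^bsub>K\<^esub> b) < 1"
proof -
  interpret group K by fact
  let ?A = "\<lambda>k. (\<lambda>b. \<sigma> (k \<otimes>\<^bsub>K\<^esub> inv\<^bsub>K\<^esub> b)) ` B"
  define d where "d k = Inf (?A k)" for k
  have nonneg: "0 \<le> \<sigma> k" if "k \<in> carrier K" for k using sn that by (simp add: group_seminorm_def)
  have bdd: "bdd_below (?A k)" if "k \<in> carrier K" for k
    using that B(1) nonneg by (intro bdd_belowI2[where m = 0]) auto
  have d0: "0 \<le> d k" if "k \<in> carrier K" for k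
    unfolding d_def using that B nonneg by (intro cInf_greatest) auto
  have d_le: "d k \<le> \<sigma> (k \<otimes>\<^bsub>K\<^esub> inv\<^bsub>K\<^esub> b)" if "k \<in> carrier K" "b \<in> B" for k b
    unfolding d_def using bdd that by (intro cInf_lower) auto
  have step: "d (g \<otimes>\<^bsub>K\<^esub> k) \<le> \<sigma> g + d k" if g: "g \<in> carrier K" and k: "k \<in> carrier K" for g k
  proof -
    have "d (g \<otimes>\<^bsub>K\<^esub> k) - \<sigma> g \<le> d k"
      unfolding d_def[of k]
    proof (rule cInf_greatest)
      fix r assume "r \<in> ?A k"
      then obtain b where b: "b \<in> B" "r = \<sigma> (k \<otimes>\<^bsub>K\<^esub> inv\<^bsub>K\<^esub> b)" by blast
      then have bK: "b \<in> carrier K" using B(1) by blast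
      have "\<sigma> (g \<otimes>\<^bsub>K\<^esub> (k \<otimes>\<^bsub>K\<^esub> inv\<^bsub>K\<^esub> b)) \<le> \<sigma> g + r"
        using sn g k bK b(2) by (simp add: group_seminorm_def)
      then show "d (g \<otimes>\<^bsub>K\<^esub> k) - \<sigma> g \<le> r"
        using d_le[of "g \<otimes>\<^bsub>K\<^esub> k" b] g k bK b(1) by (simp add: m_assoc)
    qed (use B in simp)
    then show ?thesis by simp
  qed
  have lip: "\<bar>d (g \<otimes>\<^bsub>K\<^esub> k) - d k\<bar> \<le> \<sigma> g" if g: "g \<in> carrier K" and k: "k \<in> carrier K" for g k
  proof -
    have "inv\<^bsub>K\<^esub> g \<otimes>\<^bsub>K\<^esub> (g \<otimes>\<^bsub>K\<^esub> k) = k" using g k by (simp flip: m_assoc)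
    then have "d k \<le> \<sigma> g + d (g \<otimes>\<^bsub>K\<^esub> k)"
      using step[of "inv\<^bsub>K\<^esub> g" "g \<otimes>\<^bsub>K\<^esub> k"] g k sn by (simp add: group_seminorm_def)
    then show ?thesis using step[OF g k] by linarith
  qed
  let ?f = "\<lambda>k\<in>carrier K. min 1 (d k)"
  have "\<bar>min 1 (d (g \<otimes>\<^bsub>K\<^esub> k)) - min 1 (d k)\<bar> \<le> \<sigma> g" if "g \<in> carrier K" "k \<in> carrier K" for g k
    using lip[OF that] by (simp add: min_def abs_if split: if_splits)
  then have "?f \<in> Lip K \<sigma>" using d0 by (simp add: Lip_def)
  moreover have "?f b = 0" if b: "b \<in> B" for b
  proof -
    have bK: "b \<in> carrier K" using b B(1) by blast
    then have "d b \<le> 0" using d_le[OF bK b] group_seminorm_one[OF is_group sn] by simp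
    then show ?thesis using d0[OF bK] bK by simp
  qed
  moreover have "\<exists>b\<in>B. \<sigma> (k \<otimes>\<^bsub>K\<^esub> inv\<^bsub>K\<^esub> b) < 1" if k: "k \<in> carrier K" and less: "?f k < 1" for k
  proof -
    have "Inf (?A k) < 1" using k less by (simp add: d_def)
    then show ?thesis using cInf_lessD[of "?A k" 1] B(2) by auto
  qed
  ultimately show ?thesis by (rule that)
qed

lemma AP_pullback:
  assumes K: "group_flow K S X \<phi>" and G: "group_flow G T X (\<lambda>g. \<phi> (\<pi> g))"
    and surj: "\<pi> ` carrier G = carrier K"
  shows "AP G T X (\<lambda>g. \<phi> (\<pi> g)) = AP K S X \<phi>"
proof -
  interpret K: group_flow K S X \<phi> by fact
  interpret G: group_flow G T X "\<lambda>g. \<phi> (\<pi> g)" by fact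
  have "subflow G X (\<lambda>g. \<phi> (\<pi> g)) Y \<longleftrightarrow> subflow K X \<phi> Y" for Y
    unfolding subflow_def surj[symmetric] by blast
  then show ?thesis
    by (auto simp: G.AP_minimal K.AP_minimal G.minimal_subflow_def K.minimal_subflow_def)
qed

text \<open>A return set of a point \<open>x\<close> is encoded by the Lipschitz function \<open>f\<close> measuring the distance to
  its image \<open>B\<close> in \<open>K\<close>.  That function need not be almost periodic, so it is replaced: a minimal set in the
  orbit closure of \<open>(x, f)\<close> projects onto the orbit closure of \<open>x\<close> and thus contains some \<open>(x, q)\<close>
  with \<open>q\<close> almost periodic.  Closed conditions on the orbit of \<open>(x, f)\<close> survive in \<open>(x, q)\<close>: they give
  \<open>q(1) = 0\<close>, and \<open>b x\<close> in the closure of \<open>W (U \<inter> G x)\<close> whenever \<open>q(\<pi> b) < 1\<close>.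

  The result is used with \<open>\<pi>\<close> the identity of \<open>H\<close> and with \<open>\<pi>\<close> the projection onto \<open>K\<close>; in the second
  case no quotient space of \<open>X\<close> by \<open>H\<close> is formed, whose Hausdorff property would be an issue.\<close>

lemma recurrence_from_quotient:
  fixes G :: "('g, 'm) monoid_scheme" (structure) and K :: "('k, 'n) monoid_scheme"
  assumes tgK: "topological_group K S" and hom: "\<pi> \<in> hom G K" and cont: "continuous_map T S \<pi>"
    and surj: "\<pi> ` carrier G = carrier K" and sn: "group_seminorm K S \<sigma>"
    and F: "\<And>f h. f \<in> AP K S (Lip_topology K \<sigma>) (shift K \<sigma>) \<Longrightarrow> f \<one>\<^bsub>K\<^esub> = 0 \<Longrightarrow> h \<in> carrier K \<Longrightarrow>
       \<exists>k\<in>F. f (k \<otimes>\<^bsub>K\<^esub> h) < 1"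
    and W: "\<And>g. g \<in> carrier G \<Longrightarrow> \<sigma> (\<pi> g) < 1 \<Longrightarrow> g \<in> W"
    and X: "group_flow G T X \<phi>" and x: "x \<in> AP G T X \<phi>" and U: "openin X U" "x \<in> U"
    and g: "g \<in> carrier G" and lift: "\<And>k. k \<in> F \<Longrightarrow> s k \<in> carrier G \<and> \<pi> (s k) = k"
  shows "\<exists>k\<in>F. \<phi> (s k) (\<phi> g x) \<in> X closure_of {\<phi> w y | w y. w \<in> W \<and> y \<in> U \<inter> orbit G \<phi> x}"
proof -
  interpret X: group_flow G T X \<phi> by fact
  interpret K: group K using tgK by (simp add: topological_group_def)
  interpret \<pi>: group_hom G K \<pi>
    using hom K.is_group X.is_group by (simp add: group_hom_def group_hom_axioms_def)
  define D where "D = X closure_of {\<phi> w y | w y. w \<in> W \<and> y \<in> U \<inter> orbit G \<phi> x}"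
  let ?L = "Lip_topology K \<sigma>" and ?\<tau> = "\<lambda>g. shift K \<sigma> (\<pi> g)"
  have KL: "group_flow K S ?L (shift K \<sigma>)" using tgK sn by (rule flow_Lip)
  interpret L: group_flow G T ?L ?\<tau> using KL X.tg hom cont by (rule group_flow_pullback)
  let ?P = "prod_topology X ?L"
  define \<rho> where "\<rho> = (\<lambda>g. \<lambda>(y, f)\<in>topspace X \<times> topspace ?L. (\<phi> g y, ?\<tau> g f))"
  interpret P: group_flow G T ?P \<rho>
    unfolding \<rho>_def using X.group_flow_axioms L.group_flow_axioms by (rule group_flow_prod)
  have \<rho>: "\<rho> g (y, f) = (\<phi> g y, ?\<tau> g f)" if "y \<in> topspace X" "f \<in> Lip K \<sigma>" for g y f
    using that by (simp add: \<rho>_def)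
  have xX: "x \<in> topspace X" using x X.AP_subset by blast
  let ?M = "X closure_of (orbit G \<phi> x)"
  have M: "X.minimal_subflow ?M" using x by (rule X.AP_orbit_closure)
  have \<tau>: "?\<tau> a f k = f (k \<otimes>\<^bsub>K\<^esub> \<pi> a)" if "f \<in> Lip K \<sigma>" "k \<in> carrier K" for a f k
    using that by (simp add: shift_def)
  have L_eval: "continuous_map ?P euclideanreal (\<lambda>p. snd p k)" if "k \<in> carrier K" for k
    using continuous_map_compose[OF continuous_map_snd continuous_map_eval_Lip[OF that]]
    by (simp add: o_def)

  define B where "B = \<pi> ` {c \<in> carrier G. \<phi> c x \<in> U}"
  have "\<one> \<in> {c \<in> carrier G. \<phi> c x \<in> U}" using U xX by simp
  then have "B \<noteq> {}" "B \<subseteq> carrier K" by (auto simp: B_def)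
  then obtain f where f: "f \<in> Lip K \<sigma>" "\<And>b. b \<in> B \<Longrightarrow> f b = 0"
    "\<And>k. k \<in> carrier K \<Longrightarrow> f k < 1 \<Longrightarrow> \<exists>b\<in>B. \<sigma> (k \<otimes>\<^bsub>K\<^esub> inv\<^bsub>K\<^esub> b) < 1"
    using truncated_distance_Lip[OF K.is_group sn] by metis
  have xf: "(x, f) \<in> topspace ?P" using xX f(1) by simp
  obtain N where N: "P.minimal_subflow N" "N \<subseteq> ?P closure_of (orbit G \<rho> (x, f))"
    by (rule P.ex_minimal_subflow[OF P.orbit_closure_subflow[OF xf]]) (rule that)
  have sN: "subflow G ?P \<rho> N" using N(1) by (simp add: P.minimal_subflow_def)
  have N_sub: "N \<subseteq> topspace X \<times> Lip K \<sigma>" using P.subflow_subset[OF sN] by simp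
  have "fst ` N = ?M"
  proof -
    have "subflow G X \<phi> (fst ` N)"
      by (rule subflow_image[OF P.group_flow_axioms X.group_flow_axioms continuous_map_fst _ sN])
         (use N_sub \<rho> in auto)
    moreover have "fst ` N \<subseteq> ?M"
    proof clarify
      fix y q assume yq: "(y, q) \<in> N"
      have "(y, q) \<in> {p \<in> topspace ?P. fst p \<in> ?M}"
      proof (rule P.orbit_closure_induct[OF _ xf])
        show "(y, q) \<in> ?P closure_of (orbit G \<rho> (x, f))" using yq N(2) by blast
        show "closedin ?P {p \<in> topspace ?P. fst p \<in> ?M}"
          by (rule closedin_continuous_map_preimage[OF continuous_map_fst]) simp
        fix a assume a: "a \<in> carrier G"
        have "\<phi> a x \<in> ?M"
          using subflow_closed[OF X.orbit_closure_subflow[OF xX] a X.in_orbit_closure[OF xX]] .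
        then show "\<rho> a (x, f) \<in> {p \<in> topspace ?P. fst p \<in> ?M}"
          using a xX f(1) P.act_closed[OF a xf] by (simp add: \<rho>)
      qed
      then show "fst (y, q) \<in> ?M" by simp
    qed
    ultimately show ?thesis using M unfolding X.minimal_subflow_def by blast
  qed
  then have "x \<in> fst ` N" using X.in_orbit_closure[OF xX] by simp
  then obtain q where q: "(x, q) \<in> N" by auto
  then have qL: "q \<in> Lip K \<sigma>" and q_cl: "(x, q) \<in> ?P closure_of (orbit G \<rho> (x, f))"
    using N_sub N(2) by auto
  have "L.minimal_subflow (snd ` N)"
    by (rule minimal_subflow_image[OF P.group_flow_axioms L.group_flow_axioms continuous_map_snd _ N(1)])
       (use N_sub \<rho> in auto)
  then have "q \<in> AP G T ?L ?\<tau>" unfolding L.AP_minimal using q by force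
  then have qAP: "q \<in> AP K S ?L (shift K \<sigma>)"
    using AP_pullback[OF KL L.group_flow_axioms surj] by simp

  have "(x, q) \<in> {p \<in> topspace ?P. fst p \<in> topspace X - U} \<union> {p \<in> topspace ?P. snd p \<one>\<^bsub>K\<^esub> \<in> {0}}"
  proof (rule P.orbit_closure_induct[OF q_cl xf])
    show "closedin ?P ({p \<in> topspace ?P. fst p \<in> topspace X - U} \<union> {p \<in> topspace ?P. snd p \<one>\<^bsub>K\<^esub> \<in> {0}})"
      using U(1) K.one_closed
      by (intro closedin_Un closedin_continuous_map_preimage[OF continuous_map_fst]
          closedin_continuous_map_preimage[OF L_eval]) auto
    fix a assume a: "a \<in> carrier G"
    have "f (\<pi> a) = 0" if "\<phi> a x \<in> U" using a that f(2) by (simp add: B_def)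
    then have "\<phi> a x \<in> topspace X - U \<or> ?\<tau> a f \<one>\<^bsub>K\<^esub> = 0"
      using a xX f(1) by (auto simp: \<tau>)
    then show "\<rho> a (x, f) \<in> {p \<in> topspace ?P. fst p \<in> topspace X - U} \<union> {p \<in> topspace ?P. snd p \<one>\<^bsub>K\<^esub> \<in> {0}}"
      using P.act_closed[OF a xf] xX f(1) by (auto simp: \<rho>)
  qed
  then have q1: "q \<one>\<^bsub>K\<^esub> = 0" using U(2) by simp
  have near: "\<phi> b x \<in> D" if b: "b \<in> carrier G" and less: "q (\<pi> b) < 1" for b
  proof -
    let ?C1 = "{p \<in> topspace ?P. snd p (\<pi> b) \<in> {1..}}" and ?C2 = "{p \<in> topspace ?P. fst p \<in> {y \<in> topspace X. \<phi> b y \<in> D}}"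
    have "(x, q) \<in> ?C1 \<union> ?C2"
    proof (rule P.orbit_closure_induct[OF q_cl xf])
      show "closedin ?P (?C1 \<union> ?C2)"
        using b by (intro closedin_Un closedin_continuous_map_preimage[OF continuous_map_fst]
            closedin_continuous_map_preimage[OF L_eval] X.closedin_translate)
          (auto simp: D_def)
      fix a assume a: "a \<in> carrier G"
      have "\<phi> b (\<phi> a x) \<in> D" if fless: "f (\<pi> b \<otimes>\<^bsub>K\<^esub> \<pi> a) < 1"
      proof -
        obtain c where c: "c \<in> carrier G" "\<phi> c x \<in> U"
          and \<sigma>: "\<sigma> (\<pi> b \<otimes>\<^bsub>K\<^esub> \<pi> a \<otimes>\<^bsub>K\<^esub> inv\<^bsub>K\<^esub> (\<pi> c)) < 1"
          using f(3)[OF _ fless] a b by (auto simp: B_def)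
        let ?w = "b \<otimes> a \<otimes> inv c"
        have w: "?w \<in> carrier G" "?w \<in> W" using a b c \<sigma> by (auto intro!: W)
        have "\<phi> ?w (\<phi> c x) = \<phi> (b \<otimes> a \<otimes> inv c \<otimes> c) x" using w c(1) xX by (simp add: X.act_mult)
        also have "b \<otimes> a \<otimes> inv c \<otimes> c = b \<otimes> a" using a b c(1) by (simp add: X.m_assoc)
        finally have "\<phi> b (\<phi> a x) = \<phi> ?w (\<phi> c x)" using a b xX by (simp add: X.act_mult)
        moreover have "\<phi> c x \<in> U \<inter> orbit G \<phi> x" using c by (auto simp: orbit_def)
        ultimately have "\<phi> b (\<phi> a x) \<in> {\<phi> w y | w y. w \<in> W \<and> y \<in> U \<inter> orbit G \<phi> x}"
          using w(2) by blast
        moreover have "\<phi> b (\<phi> a x) \<in> topspace X" using a b xX by simp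
        ultimately show ?thesis unfolding D_def
          by (metis (no_types, lifting) Int_iff closure_of_subset_Int subsetD)
      qed
      then have "\<phi> b (\<phi> a x) \<in> D \<or> 1 \<le> f (\<pi> b \<otimes>\<^bsub>K\<^esub> \<pi> a)" by (meson not_less)
      then show "\<rho> a (x, f) \<in> ?C1 \<union> ?C2"
        using P.act_closed[OF a xf] xX f(1) a b by (auto simp: \<rho> \<tau>)
    qed
    then show ?thesis using less by auto
  qed
  obtain k where k: "k \<in> F" "q (k \<otimes>\<^bsub>K\<^esub> \<pi> g) < 1" using F[OF qAP q1, of "\<pi> g"] g by auto
  have "\<phi> (s k \<otimes> g) x \<in> D" using lift[OF k(1)] k(2) g by (intro near) auto
  then have "\<phi> (s k) (\<phi> g x) \<in> D" using lift[OF k(1)] g xX by (simp add: X.act_mult)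
  then show ?thesis using k(1) by (auto simp: D_def)
qed

text \<open>A closed neighbourhood \<open>C\<close> of \<open>x\<close> disjoint from a hypothetical smaller subflow \<open>Y\<close> leads to a
  contradiction: the union \<open>?D\<close> of the finitely many sets \<open>inv k C\<close> is closed and contains the orbits
  of nearby almost periodic points, hence that of \<open>x\<close>, hence \<open>Y\<close>.\<close>

lemma CAP_on_if_uniformly_recurrent:
  fixes G :: "('g, 'm) monoid_scheme" (structure)
  assumes tg: "topological_group G T"
    and rec: "\<And>U. openin T U \<Longrightarrow> \<one> \<in> U \<Longrightarrow> \<exists>F. finite F \<and> F \<subseteq> carrier G \<and>
      (\<forall>(X :: 'x topology) \<phi> x V g. group_flow G T X \<phi> \<longrightarrow> x \<in> AP G T X \<phi> \<longrightarrow> openin X V \<longrightarrow> x \<in> V \<longrightarrow>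
         g \<in> carrier G \<longrightarrow> (\<exists>k\<in>F. \<phi> k (\<phi> g x) \<in> X closure_of {\<phi> u y | u y. u \<in> U \<and> y \<in> V}))"
  shows "CAP_on TYPE('x) G T"
  unfolding CAP_on_def
proof (intro allI impI)
  fix X :: "'x topology" and \<phi> assume "flow G T X \<phi>"
  then interpret X: group_flow G T X \<phi> using tg by (simp add: group_flow_def)
  have "x \<in> AP G T X \<phi>" if xcl: "x \<in> X closure_of (AP G T X \<phi>)" for x
  proof -
    have x: "x \<in> topspace X" using xcl by (simp add: in_closure_of)
    have "x \<in> Y" if Y: "subflow G X \<phi> Y" "Y \<subseteq> X closure_of (orbit G \<phi> x)" for Y
    proof (rule ccontr)
      assume "x \<notin> Y"
      then have "openin X (topspace X - Y)" "x \<in> topspace X - Y" using Y(1) x by (auto simp: subflow_def)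
      moreover have "regular_space X"
        using X.compact X.Hausdorff by (rule compact_Hausdorff_imp_regular_space)
      ultimately obtain V C where V: "openin X V" "closedin X C" "x \<in> V" "V \<subseteq> C" "C \<subseteq> topspace X - Y"
        unfolding neighbourhood_base_of_closedin[symmetric] neighbourhood_base_of by meson
      have "openin (prod_topology T X) {p \<in> topspace (prod_topology T X). (\<lambda>(g, x). \<phi> g x) p \<in> V}"
        using X.cont V(1) by (rule openin_continuous_map_preimage)
      moreover have "(\<one>, x) \<in> {p \<in> topspace (prod_topology T X). (\<lambda>(g, x). \<phi> g x) p \<in> V}"
        using V(3) x X.topT by simp
      ultimately obtain U V' where U: "openin T U" "openin X V'" "\<one> \<in> U" "x \<in> V'"
        "U \<times> V' \<subseteq> {p \<in> topspace (prod_topology T X). (\<lambda>(g, x). \<phi> g x) p \<in> V}"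
        unfolding openin_prod_topology_alt by meson
      then have UV: "\<phi> u y \<in> V" if "u \<in> U" "y \<in> V'" for u y using that by auto
      from rec[OF U(1,3)] obtain F where F: "finite F" "F \<subseteq> carrier G"
        and all: "\<forall>(X :: 'x topology) \<phi> x V g. group_flow G T X \<phi> \<longrightarrow> x \<in> AP G T X \<phi> \<longrightarrow> openin X V \<longrightarrow> x \<in> V \<longrightarrow>
         g \<in> carrier G \<longrightarrow> (\<exists>k\<in>F. \<phi> k (\<phi> g x) \<in> X closure_of {\<phi> u y | u y. u \<in> U \<and> y \<in> V})"
        by (elim exE conjE) (rule that)
      have near: "\<exists>k\<in>F. \<phi> k (\<phi> g y) \<in> X closure_of {\<phi> u y | u y. u \<in> U \<and> y \<in> V'}"
        if "y \<in> AP G T X \<phi>" "y \<in> V'" "g \<in> carrier G" for y g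
        using all[rule_format, OF X.group_flow_axioms that(1) U(2) that(2,3)] .
      have sub: "X closure_of {\<phi> u y | u y. u \<in> U \<and> y \<in> V'} \<subseteq> C"
        using UV V(2,4) by (intro closure_of_minimal) auto
      let ?D = "\<Union>k\<in>F. {y \<in> topspace X. \<phi> k y \<in> C}"
      have clD: "closedin X ?D"
        using F(1,2) V(2) by (intro closedin_Union) (auto intro: X.closedin_translate)
      have orbD: "\<phi> g x \<in> ?D" if g: "g \<in> carrier G" for g
      proof -
        have "x \<in> X closure_of (V' \<inter> AP G T X \<phi>)"
          using xcl U(2,4) openin_Int_closure_of_subset by blast
        moreover have "closedin X {y \<in> topspace X. \<phi> g y \<in> ?D}"
          using g clD by (rule X.closedin_translate)
        moreover have "V' \<inter> AP G T X \<phi> \<subseteq> {y \<in> topspace X. \<phi> g y \<in> ?D}"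
        proof
          fix y assume y: "y \<in> V' \<inter> AP G T X \<phi>"
          then have yX: "y \<in> topspace X" using X.AP_subset by blast
          obtain k where "k \<in> F" "\<phi> k (\<phi> g y) \<in> C" using near[of y g] y g sub by blast
          then show "y \<in> {y \<in> topspace X. \<phi> g y \<in> ?D}" using yX g by auto
        qed
        ultimately have "x \<in> {y \<in> topspace X. \<phi> g y \<in> ?D}" using closure_of_minimal by blast
        then show ?thesis by simp
      qed
      obtain y where y: "y \<in> Y" using Y(1) by (auto simp: subflow_def)
      have "y \<in> ?D" using X.orbit_closure_induct[OF _ x clD orbD] y Y(2) by blast
      then obtain k where k: "k \<in> F" "\<phi> k y \<in> C" by blast
      moreover have "\<phi> k y \<in> Y" using subflow_closed[OF Y(1) _ y] F(2) k(1) by blast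
      ultimately show False using V(5) by blast
    qed
    then have "X.minimal_subflow (X closure_of (orbit G \<phi> x))"
      using X.orbit_closure_subflow[OF x] X.orbit_closure_least
      unfolding X.minimal_subflow_def by (metis subset_antisym)
    then show ?thesis using X.AP_minimal X.in_orbit_closure[OF x] by blast
  qed
  then show "closedin X (AP G T X \<phi>)"
    using X.AP_subset by (metis closure_of_eq closure_of_subset subsetI subset_antisym)
qed

section \<open>Extensions\<close>

text \<open>Normality makes the set of \<open>H\<close>-almost periodic points invariant under \<open>G\<close>, and CAP makes it
  closed; so it contains each minimal \<open>G\<close>-subflow, in which it has a point by Zorn's lemma.\<close>

lemma AP_subset_AP_normal_subgroup:
  fixes G :: "('g, 'm) monoid_scheme" (structure) and X :: "'x topology"
  assumes X: "group_flow G T X \<phi>" and HX: "group_flow (G\<lparr>carrier := H\<rparr>) T' X \<phi>"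
    and H: "H \<lhd> G" and cap: "CAP_on TYPE('x) (G\<lparr>carrier := H\<rparr>) T'"
  shows "AP G T X \<phi> \<subseteq> AP (G\<lparr>carrier := H\<rparr>) T' X \<phi>"
proof
  interpret X: group_flow G T X \<phi> by fact
  interpret H: group_flow "G\<lparr>carrier := H\<rparr>" T' X \<phi> by fact
  interpret normal H G by fact
  let ?A = "AP (G\<lparr>carrier := H\<rparr>) T' X \<phi>"
  have HG: "h \<in> carrier G" if "h \<in> H" for h using that by (rule mem_carrier)
  have translate: "subflow (G\<lparr>carrier := H\<rparr>) X \<phi> (\<phi> g ` Y)"
    if g: "g \<in> carrier G" and Y: "subflow (G\<lparr>carrier := H\<rparr>) X \<phi> Y" for g Y
  proof -
    have YX: "Y \<subseteq> topspace X" using H.subflow_subset[OF Y] .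
    have "closedin X (\<phi> g ` Y)"
      using T1_Spaces.continuous_imp_closed_map[OF X.cont_act[OF g] X.compact X.Hausdorff] Y
      by (simp add: closed_map_def subflow_def)
    moreover have "\<phi> h (\<phi> g y) \<in> \<phi> g ` Y" if h: "h \<in> H" and y: "y \<in> Y" for h y
    proof -
      have "inv g \<otimes> h \<otimes> g \<in> H" using h g inv_op_closed1 by blast
      then have "\<phi> (inv g \<otimes> h \<otimes> g) y \<in> Y" using subflow_closed[OF Y _ y] by simp
      moreover have "\<phi> g (\<phi> (inv g \<otimes> h \<otimes> g) y) = \<phi> h (\<phi> g y)"
      proof -
        have "\<phi> g (\<phi> (inv g \<otimes> h \<otimes> g) y) = \<phi> (g \<otimes> (inv g \<otimes> h \<otimes> g)) y"
          using g HG[OF h] y YX by (subst X.act_mult) auto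
        also have "g \<otimes> (inv g \<otimes> h \<otimes> g) = h \<otimes> g" using g HG[OF h] by (simp flip: X.m_assoc)
        finally show ?thesis using g HG[OF h] y YX by (simp add: X.act_mult subset_iff)
      qed
      ultimately show ?thesis by (metis imageI)
    qed
    ultimately show ?thesis using Y by (auto simp: subflow_def)
  qed
  have invariant: "\<phi> g y \<in> ?A" if g: "g \<in> carrier G" and y: "y \<in> ?A" for g y
  proof -
    obtain N where N: "H.minimal_subflow N" "y \<in> N" using y H.AP_minimal by blast
    have sN: "subflow (G\<lparr>carrier := H\<rparr>) X \<phi> N" using N(1) by (simp add: H.minimal_subflow_def)
    have NX: "N \<subseteq> topspace X" using H.subflow_subset[OF sN] .
    have "Z = \<phi> g ` N" if Z: "subflow (G\<lparr>carrier := H\<rparr>) X \<phi> Z" "Z \<subseteq> \<phi> g ` N" for Z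
    proof -
      have "\<phi> (inv g) z \<in> N" if z: "z \<in> Z" for z
      proof -
        obtain y where "y \<in> N" "z = \<phi> g y" using z Z(2) by blast
        then show ?thesis using NX g by auto
      qed
      then have "\<phi> (inv g) ` Z \<subseteq> N" by blast
      then have eq: "\<phi> (inv g) ` Z = N"
        using N(1) translate[OF _ Z(1), of "inv g"] g unfolding H.minimal_subflow_def by simp
      have "\<phi> g ` \<phi> (inv g) ` Z = Z"
        using H.subflow_subset[OF Z(1)] g by (force simp: image_image subset_iff)
      then show ?thesis unfolding eq by simp
    qed
    then have "H.minimal_subflow (\<phi> g ` N)" using translate[OF g sN] by (simp add: H.minimal_subflow_def)
    then show ?thesis using H.AP_minimal N(2) by blast
  qed
  fix x assume x: "x \<in> AP G T X \<phi>"
  then obtain M where M: "X.minimal_subflow M" "x \<in> M" using X.AP_minimal by blast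
  have sM: "subflow G X \<phi> M" using M(1) by (simp add: X.minimal_subflow_def)
  then have "subflow (G\<lparr>carrier := H\<rparr>) X \<phi> M" using HG by (simp add: subflow_def)
  then obtain N where N: "H.minimal_subflow N" "N \<subseteq> M"
    by (rule H.ex_minimal_subflow) (rule that)
  then have "N \<noteq> {}" by (simp add: H.minimal_subflow_def subflow_def)
  moreover have "N \<subseteq> ?A" using N(1) H.AP_minimal by blast
  ultimately have "M \<inter> ?A \<noteq> {}" using N(2) by blast
  moreover have "closedin X (M \<inter> ?A)"
    using sM cap H.fl by (intro closedin_Int) (auto simp: subflow_def CAP_on_def)
  moreover have "\<phi> g ` (M \<inter> ?A) \<subseteq> M \<inter> ?A" if "g \<in> carrier G" for g
    using subflow_closed[OF sM that] invariant[OF that] by blast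
  ultimately have "subflow G X \<phi> (M \<inter> ?A)" by (simp add: subflow_def)
  then have "M \<inter> ?A = M" using M(1) unfolding X.minimal_subflow_def by blast
  then show "x \<in> ?A" using M(2) by blast
qed

lemma short_exact_sequence_projection:
  fixes G :: "('g, 'm) monoid_scheme" (structure)
  assumes ses: "short_exact_sequence H G T \<pi> K S"
  shows "continuous_map T S \<pi>" "open_map T S \<pi>" "\<pi> ` carrier G = carrier K"
proof -
  have tg: "topological_group G T" and tgK: "topological_group K S" and hom: "\<pi> \<in> hom G K"
    and ker: "kernel G K \<pi> = H" and normal: "H \<lhd> G"
    and homeo: "homeomorphic_map (quotient_group_topology G T H) S (\<lambda>C. the_elem (\<pi> ` C))"
    using ses by (simp_all add: short_exact_sequence_def)
  interpret group G using tg by (simp add: topological_group_def)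
  interpret normal H G by fact
  interpret K: group K using tgK by (simp add: topological_group_def)
  interpret \<pi>: group_hom G K \<pi> using hom by (simp add: group_hom_def group_hom_axioms_def K.is_group)
  have top: "topspace T = carrier G" "topspace S = carrier K"
    using tg tgK by (simp_all add: topological_group_def)
  let ?Q = "quotient_group_topology G T H" and ?p = "\<lambda>C. the_elem (\<pi> ` C)" and ?q = "\<lambda>g. H #> g"
  have q: "quotient_map T ?Q ?q" using top(1) by (rule quotient_map_quotient_group_topology)
  have eq: "?p (?q g) = \<pi> g" if g: "g \<in> carrier G" for g
  proof -
    have "\<pi> h = \<one>\<^bsub>K\<^esub>" if "h \<in> H" for h using that unfolding ker[symmetric] kernel_def by simp
    then have "\<pi> ` (H #> g) \<subseteq> {\<pi> g}" using g mem_carrier by (auto simp: r_coset_def)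
    moreover have "g \<in> H #> g" using g by (rule rcos_self) (rule is_subgroup)
    ultimately have "\<pi> ` (H #> g) = {\<pi> g}" by blast
    then show ?thesis by simp
  qed
  have "continuous_map T S (?p \<circ> ?q)"
    using q homeo by (intro continuous_map_compose[of T ?Q]) (auto simp: quotient_imp_continuous_map homeomorphic_imp_continuous_map)
  then show "continuous_map T S \<pi>" by (rule continuous_map_eq) (simp add: eq top)
  have "open_map T ?Q ?q"
    unfolding open_map_def
  proof (intro allI impI)
    fix V assume V: "openin T V"
    have VG: "V \<subseteq> carrier G" using openin_subset[OF V] top by simp
    have "{g \<in> carrier G. H #> g \<in> ?q ` V} = (\<Union>h\<in>H. {g \<in> topspace T. h \<otimes> g \<in> V})"
    proof (intro equalityI subsetI)
      fix g assume g: "g \<in> {g \<in> carrier G. H #> g \<in> ?q ` V}"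
      then obtain v where v: "v \<in> V" "H #> g = H #> v" by blast
      then have "v \<in> H #> g" using VG rcos_self[OF _ is_subgroup] by auto
      then show "g \<in> (\<Union>h\<in>H. {g \<in> topspace T. h \<otimes> g \<in> V})"
        using v(1) g top by (auto simp: r_coset_def)
    next
      fix g assume "g \<in> (\<Union>h\<in>H. {g \<in> topspace T. h \<otimes> g \<in> V})"
      then obtain h where h: "h \<in> H" "g \<in> carrier G" "h \<otimes> g \<in> V" using top by auto
      then have "h \<otimes> g \<in> H #> g" by (auto simp: r_coset_def)
      then have "H #> g = H #> (h \<otimes> g)" using h(2) by (intro repr_independence is_subgroup)
      then show "g \<in> {g \<in> carrier G. H #> g \<in> ?q ` V}" using h by blast
    qed
    moreover have "openin T (\<Union>h\<in>H. {g \<in> topspace T. h \<otimes> g \<in> V})"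
      using topological_group_translations(1)[OF tg] V mem_carrier
      by (intro openin_Union) (auto intro!: openin_continuous_map_preimage)
    moreover have "?q ` V \<subseteq> carrier (G Mod H)"
      using VG by (auto simp: FactGroup_def RCOSETS_def)
    ultimately show "openin ?Q (?q ` V)" by (simp add: openin_quotient_group_topology)
  qed
  then have "open_map T S (?p \<circ> ?q)"
    using homeo by (intro open_map_compose[of T ?Q]) (auto simp: homeomorphic_imp_open_map)
  moreover have img: "(?p \<circ> ?q) ` V = \<pi> ` V" if "V \<subseteq> carrier G" for V
    using that eq by (intro image_cong) auto
  ultimately show "open_map T S \<pi>" unfolding open_map_def using openin_subset top(1) by metis
  have "?q ` carrier G = topspace ?Q" using quotient_imp_surjective_map[OF q] top by simp
  moreover have "?p ` topspace ?Q = carrier K"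
    using homeomorphic_imp_surjective_map[OF homeo] top by simp
  ultimately show "\<pi> ` carrier G = carrier K" using img[of "carrier G"] by (metis image_comp subset_refl)
qed

theorem theorem7p5:
  fixes G :: "('g, 'm) monoid_scheme" and T :: "'g topology"
    and K :: "('k, 'n) monoid_scheme" and S :: "'k topology"
    and H :: "'g set" and \<pi> :: "'g \<Rightarrow> 'k"
  assumes "short_exact_sequence H G T \<pi> K S"
    and "CAP (G\<lparr>carrier := H\<rparr>) (subtopology T H)"
    and "CAP K S"
  shows "CAP G T"
proof -
  let ?H = "G\<lparr>carrier := H\<rparr>" and ?TH = "subtopology T H"
  have tg: "topological_group G T" and tgK: "topological_group K S" and hom: "\<pi> \<in> hom G K"
    and ker: "kernel G K \<pi> = H" and normal: "H \<lhd> G"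
    using assms(1) by (simp_all add: short_exact_sequence_def)
  note \<pi> = short_exact_sequence_projection[OF assms(1)]
  interpret group G using tg by (simp add: topological_group_def)
  interpret normal H G by fact
  interpret K: group K using tgK by (simp add: topological_group_def)
  interpret \<pi>: group_hom G K \<pi> using hom by (simp add: group_hom_def group_hom_axioms_def K.is_group)
  have top: "topspace T = carrier G" using tg by (simp add: topological_group_def)
  have tgH: "topological_group ?H ?TH" using tg is_subgroup by (rule topological_group_subgroup)
  have HG: "h \<in> carrier G" if "h \<in> H" for h using that by (rule mem_carrier)
  have idH: "(\<lambda>g. g) \<in> hom ?H ?H" "(\<lambda>g. g) \<in> hom ?H G"
    using HG by (auto simp: hom_def)
  have restrict: "group_flow ?H ?TH X \<phi>" if "group_flow G T X \<phi>" for X :: "('g \<Rightarrow> real) topology" and \<phi>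
    using group_flow_pullback[OF that tgH idH(2)] by (simp add: continuous_map_from_subtopology id_def[symmetric])
  have "CAP_on TYPE('g \<Rightarrow> real) G T"
  proof (rule CAP_on_if_uniformly_recurrent[OF tg])
    fix U assume U: "openin T U" "\<one>\<^bsub>G\<^esub> \<in> U"
    obtain U0 where U0: "openin T U0" "\<one>\<^bsub>G\<^esub> \<in> U0" "U0 \<subseteq> U"
      "\<And>a b. a \<in> U0 \<Longrightarrow> b \<in> U0 \<Longrightarrow> a \<otimes>\<^bsub>G\<^esub> b \<in> U"
      by (rule topological_group_nbhd_mult[OF tg U]) (rule that)
    have U0G: "U0 \<subseteq> carrier G" using openin_subset[OF U0(1)] top by simp
    have "openin ?TH (U0 \<inter> H)" using U0(1) by (simp add: openin_subtopology_Int)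
    moreover have "\<one>\<^bsub>?H\<^esub> \<in> U0 \<inter> H" using U0(2) by simp
    ultimately obtain \<sigma>H where sH: "group_seminorm ?H ?TH \<sigma>H"
      and \<sigma>H: "\<And>h. h \<in> carrier ?H \<Longrightarrow> \<sigma>H h < 1 \<Longrightarrow> h \<in> U0 \<inter> H"
      using Birkhoff_Kakutani[OF tgH] by metis
    obtain FH where FH: "finite FH" "FH \<subseteq> carrier ?H"
      "\<And>f h. f \<in> AP ?H ?TH (Lip_topology ?H \<sigma>H) (shift ?H \<sigma>H) \<Longrightarrow> f \<one>\<^bsub>?H\<^esub> = 0 \<Longrightarrow> h \<in> carrier ?H \<Longrightarrow>
         \<exists>k\<in>FH. f (k \<otimes>\<^bsub>?H\<^esub> h) < 1"
      by (rule CAP_uniformly_recurrent[OF tgH assms(2) sH]) (rule that)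
    have FHG: "f \<in> carrier G" if "f \<in> FH" for f using that FH(2) HG by auto
    \<comment> \<open>Conjugation by the return times of \<open>H\<close> takes \<open>V\<close> into \<open>U0\<close>, which lets them move past \<open>V\<close>.\<close>
    define V where "V = (\<Inter>f\<in>FH. {v \<in> topspace T. f \<otimes>\<^bsub>G\<^esub> v \<otimes>\<^bsub>G\<^esub> inv\<^bsub>G\<^esub> f \<in> U0}) \<inter> topspace T"
    have "openin T V"
      unfolding V_def
    proof (intro openin_INT FH(1))
      fix f assume f: "f \<in> FH"
      have "continuous_map T T (\<lambda>v. f \<otimes>\<^bsub>G\<^esub> v \<otimes>\<^bsub>G\<^esub> inv\<^bsub>G\<^esub> f)"
        using continuous_map_compose[OF topological_group_translations(1)[OF tg FHG[OF f]]
            topological_group_translations(2)[OF tg, of "inv\<^bsub>G\<^esub> f"]] FHG[OF f] by (simp add: o_def)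
      then show "openin T {v \<in> topspace T. f \<otimes>\<^bsub>G\<^esub> v \<otimes>\<^bsub>G\<^esub> inv\<^bsub>G\<^esub> f \<in> U0}"
        using U0(1) by (rule openin_continuous_map_preimage)
    qed
    then have "openin S (\<pi> ` V)" using \<pi>(2) by (simp add: open_map_def)
    moreover have "\<one>\<^bsub>G\<^esub> \<in> V" using U0(2) FHG top by (auto simp: V_def)
    then have "\<one>\<^bsub>K\<^esub> \<in> \<pi> ` V" by (metis \<pi>.hom_one imageI)
    ultimately obtain \<sigma>K where sK: "group_seminorm K S \<sigma>K"
      and \<sigma>K: "\<And>k. k \<in> carrier K \<Longrightarrow> \<sigma>K k < 1 \<Longrightarrow> k \<in> \<pi> ` V"
      using Birkhoff_Kakutani[OF tgK] by metis
    obtain FK where FK: "finite FK" "FK \<subseteq> carrier K"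
      "\<And>f h. f \<in> AP K S (Lip_topology K \<sigma>K) (shift K \<sigma>K) \<Longrightarrow> f \<one>\<^bsub>K\<^esub> = 0 \<Longrightarrow> h \<in> carrier K \<Longrightarrow>
         \<exists>k\<in>FK. f (k \<otimes>\<^bsub>K\<^esub> h) < 1"
      by (rule CAP_uniformly_recurrent[OF tgK assms(3) sK]) (rule that)
    define s where "s k = (SOME g. g \<in> carrier G \<and> \<pi> g = k)" for k
    have s: "s k \<in> carrier G \<and> \<pi> (s k) = k" if k: "k \<in> FK" for k
    proof -
      have "k \<in> \<pi> ` carrier G" unfolding \<pi>(3) using k FK(2) by (rule rev_subsetD)
      then have "\<exists>g. g \<in> carrier G \<and> \<pi> g = k" by (elim imageE) auto
      then show ?thesis unfolding s_def by (rule someI_ex)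
    qed
    define W where "W = {v \<otimes>\<^bsub>G\<^esub> h | v h. v \<in> V \<and> h \<in> H}"
    have W: "g \<in> W" if g: "g \<in> carrier G" "\<sigma>K (\<pi> g) < 1" for g
    proof -
      obtain v where v: "v \<in> V" "\<pi> g = \<pi> v" using \<sigma>K[of "\<pi> g"] g by auto
      have vG: "v \<in> carrier G" using v(1) top by (simp add: V_def)
      then have "inv\<^bsub>G\<^esub> v \<otimes>\<^bsub>G\<^esub> g \<in> H" unfolding ker[symmetric] kernel_def using g v by simp
      moreover have "g = v \<otimes>\<^bsub>G\<^esub> (inv\<^bsub>G\<^esub> v \<otimes>\<^bsub>G\<^esub> g)" using vG g by (simp flip: m_assoc)
      ultimately show ?thesis unfolding W_def using v(1) by blast
    qed
    define F where "F = (\<lambda>(f, k). f \<otimes>\<^bsub>G\<^esub> s k) ` (FH \<times> FK)"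
    have "finite F" "F \<subseteq> carrier G" using FH(1) FK(1) FHG s by (auto simp: F_def)
    moreover have "\<exists>a\<in>F. \<phi> a (\<phi> g x) \<in> X closure_of {\<phi> u y | u y. u \<in> U \<and> y \<in> N}"
      if X: "group_flow G T X \<phi>" and x: "x \<in> AP G T X \<phi>" and N: "openin X N" "x \<in> N" and g: "g \<in> carrier G"
      for X :: "('g \<Rightarrow> real) topology" and \<phi> x N g
    proof -
      interpret X: group_flow G T X \<phi> by fact
      have XH: "group_flow ?H ?TH X \<phi>" using X by (rule restrict)
      have xX: "x \<in> topspace X" using x X.AP_subset by blast
      have "CAP_on TYPE('g \<Rightarrow> real) ?H ?TH" using assms(2) by (simp add: CAP_def)
      then have AP_H: "AP G T X \<phi> \<subseteq> AP ?H ?TH X \<phi>"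
        by (rule AP_subset_AP_normal_subgroup[OF X XH normal])
      define D where "D = X closure_of {\<phi> u y | u y. u \<in> U \<and> y \<in> N}"
      define D0 where "D0 = X closure_of {\<phi> u y | u y. u \<in> U0 \<and> y \<in> N}"
      \<comment> \<open>The product of neighbourhoods \<open>U0 U0 \<subseteq> U\<close> survives taking closures.\<close>
      have U0_D0: "\<phi> u z \<in> D" if u: "u \<in> U0" and z: "z \<in> D0" for u z
      proof -
        have uG: "u \<in> carrier G" using u U0G by blast
        have NX: "N \<subseteq> topspace X" using N(1) by (rule openin_subset)
        have "{\<phi> v y | v y. v \<in> U0 \<and> y \<in> N} \<subseteq> {y \<in> topspace X. \<phi> u y \<in> D}"
        proof clarify
          fix v y assume v: "v \<in> U0" and y: "y \<in> N"
          have vG: "v \<in> carrier G" and yX: "y \<in> topspace X" using v U0G y NX by auto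
          have "\<phi> u (\<phi> v y) = \<phi> (u \<otimes>\<^bsub>G\<^esub> v) y" using uG vG yX by (simp add: X.act_mult)
          then have "\<phi> u (\<phi> v y) \<in> {\<phi> u y | u y. u \<in> U \<and> y \<in> N}"
            using U0(4)[OF u v] y by blast
          moreover have "\<phi> u (\<phi> v y) \<in> topspace X" using uG vG yX by simp
          ultimately have "\<phi> u (\<phi> v y) \<in> topspace X \<inter> {\<phi> u y | u y. u \<in> U \<and> y \<in> N}" by (rule IntI[rotated])
          then have "\<phi> u (\<phi> v y) \<in> D" unfolding D_def using closure_of_subset_Int by (rule subsetD[rotated])
          then show "\<phi> v y \<in> topspace X \<and> \<phi> u (\<phi> v y) \<in> D" using vG yX by simp
        qed
        moreover have "closedin X {y \<in> topspace X. \<phi> u y \<in> D}"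
          using uG by (rule X.closedin_translate) (simp add: D_def)
        ultimately have "D0 \<subseteq> {y \<in> topspace X. \<phi> u y \<in> D}"
          unfolding D0_def by (rule closure_of_minimal)
        then show ?thesis using z by blast
      qed
      let ?C = "\<Union>f\<in>FH. {z \<in> topspace X. \<phi> f z \<in> D}"
      \<comment> \<open>Return \<open>h y\<close> inside \<open>H\<close> first, then undo the factor \<open>v\<close> via \<open>f v h y = (f v inv f) (f h y)\<close>.\<close>
      have "\<phi> w y \<in> ?C" if w: "w \<in> W" and y: "y \<in> N \<inter> orbit G \<phi> x" for w y
      proof -
        obtain v h where v: "v \<in> V" and h: "h \<in> H" and w_eq: "w = v \<otimes>\<^bsub>G\<^esub> h" using w by (auto simp: W_def)
        have vG: "v \<in> carrier G" using v top by (simp add: V_def)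
        have hG: "h \<in> carrier G" using HG[OF h] .
        have yX: "y \<in> topspace X" using y X.orbit_subset[OF xX] by blast
        have M: "X.minimal_subflow (X closure_of (orbit G \<phi> x))" using x by (rule X.AP_orbit_closure)
        have "y \<in> X closure_of (orbit G \<phi> x)" using y closure_of_subset[OF X.orbit_subset[OF xX]] by blast
        then have "y \<in> AP G T X \<phi>" using M X.AP_minimal by blast
        then have "y \<in> AP ?H ?TH X \<phi>" using AP_H by blast
        then have "\<exists>f\<in>FH. \<phi> f (\<phi> h y) \<in> X closure_of {\<phi> w z | w z. w \<in> U0 \<inter> H \<and> z \<in> N \<inter> orbit ?H \<phi> y}"
          using y h FH(2)
          by (intro recurrence_from_quotient[OF tgH idH(1) _ _ sH FH(3) \<sigma>H XH _ N(1), where s = "\<lambda>g. g"]) auto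
        then obtain f where f: "f \<in> FH"
          and cl: "\<phi> f (\<phi> h y) \<in> X closure_of {\<phi> w z | w z. w \<in> U0 \<inter> H \<and> z \<in> N \<inter> orbit ?H \<phi> y}" by blast
        have "X closure_of {\<phi> w z | w z. w \<in> U0 \<inter> H \<and> z \<in> N \<inter> orbit ?H \<phi> y} \<subseteq> D0"
          unfolding D0_def by (rule closure_of_mono) blast
        then have fD0: "\<phi> f (\<phi> h y) \<in> D0" using cl by blast
        have fG: "f \<in> carrier G" using FHG[OF f] .
        let ?u = "f \<otimes>\<^bsub>G\<^esub> v \<otimes>\<^bsub>G\<^esub> inv\<^bsub>G\<^esub> f"
        have "?u \<in> U0" using v f by (simp add: V_def)
        then have "\<phi> ?u (\<phi> f (\<phi> h y)) \<in> D" using fD0 by (rule U0_D0)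
        moreover have "\<phi> ?u (\<phi> f (\<phi> h y)) = \<phi> f (\<phi> w y)"
          using fG vG hG yX by (simp add: w_eq X.act_mult)
        moreover have "\<phi> w y \<in> topspace X" using vG hG yX by (simp add: w_eq)
        ultimately show ?thesis using f by auto
      qed
      then have "{\<phi> w y | w y. w \<in> W \<and> y \<in> N \<inter> orbit G \<phi> x} \<subseteq> ?C" by blast
      moreover have "closedin X ?C"
        using FH(1) FHG by (intro closedin_Union) (auto intro!: X.closedin_translate simp: D_def)
      ultimately have sub: "X closure_of {\<phi> w y | w y. w \<in> W \<and> y \<in> N \<inter> orbit G \<phi> x} \<subseteq> ?C"
        by (rule closure_of_minimal)
      obtain k where k: "k \<in> FK"
        "\<phi> (s k) (\<phi> g x) \<in> X closure_of {\<phi> w y | w y. w \<in> W \<and> y \<in> N \<inter> orbit G \<phi> x}"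
        using recurrence_from_quotient[OF tgK hom \<pi>(1,3) sK FK(3) W X x N g s] by blast
      then obtain f where f: "f \<in> FH" "\<phi> f (\<phi> (s k) (\<phi> g x)) \<in> D" using sub by blast
      have "\<phi> (f \<otimes>\<^bsub>G\<^esub> s k) (\<phi> g x) \<in> D" using f s[OF k(1)] FHG g xX by (simp add: X.act_mult)
      moreover have "f \<otimes>\<^bsub>G\<^esub> s k \<in> F" using f(1) k(1) by (auto simp: F_def)
      ultimately show ?thesis unfolding D_def by blast
    qed
    ultimately show "\<exists>F. finite F \<and> F \<subseteq> carrier G \<and>
      (\<forall>(X :: ('g \<Rightarrow> real) topology) \<phi> x V g. group_flow G T X \<phi> \<longrightarrow> x \<in> AP G T X \<phi> \<longrightarrow> openin X V \<longrightarrow> x \<in> V \<longrightarrow>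
         g \<in> carrier G \<longrightarrow> (\<exists>k\<in>F. \<phi> k (\<phi> g x) \<in> X closure_of {\<phi> u y | u y. u \<in> U \<and> y \<in> V}))"
      by (intro exI[of _ F]) simp
  qed
  then show ?thesis by (simp add: CAP_def)
qed

end
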